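(* Let $n$ and $r$ be positive integers, let $j,k$ be integers and let $S,T\subseteq[n]$. Let $\mathrm{NCN}^{S,T}_{j,k}(n,r)$ denote the number of $r$-colored partitions $\Lambda$ of $[n]$ with $\mathrm{cr}(\Lambda)<j$, $\mathrm{ne}(\Lambda)<k$, $\min(\Lambda)=S$ and $\max(\Lambda)=T$. Then $\mathrm{NCN}^{S,T}_{j,k}(n,r)=\mathrm{NCN}^{S,T}_{k,j}(n,r)$.
   Context: $[n]=\{1,\dots,n\}$. A partition $P$ of $[n]$ is a set of disjoint nonempty subsets (blocks) with union $[n]$. $\mathrm{Arc}(P)$ is the set of pairs $(i,j)$ such that $i,j$ lie in the same block and $j$ is the least element of that block greater than $i$. $\min(P)$ and $\max(P)$ are the sets of minimal and maximal elements of the blocks of $P$. A sequence of arcs $(i_t,j_t)_{t\in[k]}$ of $P$ is a $k$-crossing if $i_1<\dots<i_k<j_1<\dots<j_k$ and a $k$-nesting if $i_1<\dots<i_k<j_k<\dots<j_1$. An $r$-colored partition of $[n]$ is a pair $\Lambda=(P,\varphi)$ with $P$ a partition of $[n]$ and $\varphi:\mathrm{Arc}(P)\to[r]$; $\Lambda$ has a $k$-crossing (resp. $k$-nesting) if $P$ has a $k$-crossing (resp. $k$-nesting) all of whose arcs have the same color under $\varphi$. $\mathrm{cr}(\Lambda)$ and $\mathrm{ne}(\Lambda)$ are the largest $k$ such that $\Lambda$ has a $k$-crossing, resp. $k$-nesting. $\min(\Lambda):=\min(P)$, $\max(\Lambda):=\max(P)$. *)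

theory Defs
  imports Main "HOL-Library.Disjoint_Sets" "HOL-Library.FuncSet"
begin

type_synonym arc = "nat \<times> nat"

definition arcs :: "nat set set \<Rightarrow> arc set" where
  "arcs P = {(i, j). \<exists>B\<in>P. i \<in> B \<and> j \<in> B \<and> i < j \<and> (\<forall>l\<in>B. i < l \<longrightarrow> j \<le> l)}"

definition block_mins :: "nat set set \<Rightarrow> nat set" where
  "block_mins P = Min ` P"

definition block_maxs :: "nat set set \<Rightarrow> nat set" where
  "block_maxs P = Max ` P"

text \<open>
  For a list \<open>[(i\<^sub>1, j\<^sub>1), \<dots>, (i\<^sub>k, j\<^sub>k)]\<close> the sortedness conditions below read
  \<open>i\<^sub>1 < \<dots> < i\<^sub>k < j\<^sub>1 < \<dots> < j\<^sub>k\<close> and \<open>i\<^sub>1 < \<dots> < i\<^sub>k < j\<^sub>k < \<dots> < j\<^sub>1\<close>, respectively.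
  The empty list is both a 0-crossing and a 0-nesting.
\<close>

definition crossing :: "nat set set \<Rightarrow> nat \<Rightarrow> arc list \<Rightarrow> bool" where
  "crossing P k as \<longleftrightarrow> length as = k \<and> set as \<subseteq> arcs P \<and>
     sorted_wrt (<) (map fst as @ map snd as)"

definition nesting :: "nat set set \<Rightarrow> nat \<Rightarrow> arc list \<Rightarrow> bool" where
  "nesting P k as \<longleftrightarrow> length as = k \<and> set as \<subseteq> arcs P \<and>
     sorted_wrt (<) (map fst as @ rev (map snd as))"

type_synonym colored_partition = "nat set set \<times> (arc \<Rightarrow> nat)"

text \<open>
  Colorings are taken extensional (\<open>undefined\<close> outside the arcs), so that distinct
  members of this set are distinct colored partitions.
\<close>

definition colored_partitions :: "nat \<Rightarrow> nat \<Rightarrow> colored_partition set" where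
  "colored_partitions n r = {(P, \<phi>). partition_on {1..n} P \<and> \<phi> \<in> arcs P \<rightarrow>\<^sub>E {1..r}}"

definition has_crossing :: "colored_partition \<Rightarrow> nat \<Rightarrow> bool" where
  "has_crossing \<Lambda> k \<longleftrightarrow>
     (\<exists>as. crossing (fst \<Lambda>) k as \<and> (\<forall>a\<in>set as. \<forall>b\<in>set as. snd \<Lambda> a = snd \<Lambda> b))"

definition has_nesting :: "colored_partition \<Rightarrow> nat \<Rightarrow> bool" where
  "has_nesting \<Lambda> k \<longleftrightarrow>
     (\<exists>as. nesting (fst \<Lambda>) k as \<and> (\<forall>a\<in>set as. \<forall>b\<in>set as. snd \<Lambda> a = snd \<Lambda> b))"

definition cr :: "colored_partition \<Rightarrow> nat" where
  "cr \<Lambda> = Max {k. has_crossing \<Lambda> k}"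

definition ne :: "colored_partition \<Rightarrow> nat" where
  "ne \<Lambda> = Max {k. has_nesting \<Lambda> k}"

definition NCN :: "nat set \<Rightarrow> nat set \<Rightarrow> int \<Rightarrow> int \<Rightarrow> nat \<Rightarrow> nat \<Rightarrow> nat" where
  "NCN S T j k n r =
     card {\<Lambda> \<in> colored_partitions n r. int (cr \<Lambda>) < j \<and> int (ne \<Lambda>) < k \<and>
             block_mins (fst \<Lambda>) = S \<and> block_maxs (fst \<Lambda>) = T}"

text \<open>
  The maxima defining \<open>cr\<close> and \<open>ne\<close> are over finite nonempty sets, and \<open>NCN\<close> is the
  cardinality of a finite set.
\<close>

lemma arcs_subset:
  assumes "partition_on {1..n} P"
  shows "arcs P \<subseteq> {1..n} \<times> {1..n}"
  using assms unfolding arcs_def partition_on_def by blast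

lemma length_le_if_sorted_fst:
  assumes "partition_on {1..n} P" "set as \<subseteq> arcs P" "sorted_wrt (<) (map fst as)"
  shows "length as \<le> n"
proof -
  have "distinct (map fst as)"
    using assms(3) by (simp add: strict_sorted_iff)
  then have "length as = card (set (map fst as))"
    by (metis distinct_card length_map)
  also have "\<dots> \<le> card {1..n}"
    using arcs_subset[OF assms(1)] assms(2) by (intro card_mono) auto
  finally show ?thesis by simp
qed

lemma has_crossing_0: "has_crossing \<Lambda> 0"
  by (simp add: has_crossing_def crossing_def)

lemma has_nesting_0: "has_nesting \<Lambda> 0"
  by (simp add: has_nesting_def nesting_def)

lemma finite_has_crossing:
  assumes "\<Lambda> \<in> colored_partitions n r"
  shows "finite {k. has_crossing \<Lambda> k}"
proof (rule finite_subset)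
  show "{k. has_crossing \<Lambda> k} \<subseteq> {..n}"
    using assms length_le_if_sorted_fst
    by (fastforce simp: colored_partitions_def has_crossing_def crossing_def sorted_wrt_append)
qed simp

lemma finite_has_nesting:
  assumes "\<Lambda> \<in> colored_partitions n r"
  shows "finite {k. has_nesting \<Lambda> k}"
proof (rule finite_subset)
  show "{k. has_nesting \<Lambda> k} \<subseteq> {..n}"
    using assms length_le_if_sorted_fst
    by (fastforce simp: colored_partitions_def has_nesting_def nesting_def sorted_wrt_append)
qed simp

lemma finite_colored_partitions: "finite (colored_partitions n r)"
proof -
  have "colored_partitions n r =
      Sigma {P. partition_on {1..n} P} (\<lambda>P. arcs P \<rightarrow>\<^sub>E {1..r})"
    by (auto simp: colored_partitions_def)
  moreover have "finite {P. partition_on {1..n} P}"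
    by (rule finite_subset[of _ "Pow (Pow {1..n})"]) (auto simp: partition_on_def)
  moreover have "finite (arcs P)" if "partition_on {1..n} P" for P
    using arcs_subset[OF that] by (rule finite_subset) simp
  ultimately show ?thesis
    by (auto intro!: finite_SigmaI finite_PiE)
qed

end

theory Submission
  imports Defs "HOL-Library.Sublist"
begin

text \<open>
  Each color class is a set of arcs with prescribed openers and closers, so it suffices to exchange
  crossings and nestings of one such set without changing its openers and closers. Read the points from
  right to left: at a closer, row-insert its opener into a standard tableau; at an opener, which is then
  the largest entry, delete it. The first row and the first column of the tableau measure
  the longest nesting and the longest crossing among the arcs that are open at that moment, because the
  lengths of monotone subsequences are invariant under Knuth moves. Row insertion is a bijection
  onto pairs of a tableau and a removable corner, and deleting the largest entry loses only the corner
  that it occupied; hence the number of arc sets leading to a tableau depends only on its shape, and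
  transposing all shapes exchanges the two statistics.
\<close>

section \<open>Knuth moves and monotone subsequences\<close>

text \<open>Fixing minima and maxima fixes the closers as \<open>{1..n} - S\<close> and the openers
  as \<open>{1..n} - T\<close>, so the points at which arcs end and start are prescribed. In a
  crossing or nesting every opener precedes every closer, hence all its arcs are open together just
  before its smallest closer. Bounding every tableau of the walk therefore bounds \<open>cr\<close>
  and \<open>ne\<close> exactly, although each tableau sees only the arcs open at one moment. A
  point may close one arc and open another, which would put two steps at one time; doubling the time
  axis separates them.

  Transposing the tableaux of a walk themselves would turn row insertion into column insertion. So
  only shapes are transposed, and two tableaux that are matched with each other may have different
  entries. The bijection is for this reason not written down but obtained by induction over time,
  from the fact that the possible tableaux one step earlier in the walk are classified by their
  shapes.\<close>

definition chain :: "(nat \<Rightarrow> nat \<Rightarrow> bool) \<Rightarrow> nat \<Rightarrow> nat list \<Rightarrow> bool" where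
  "chain R k w \<longleftrightarrow> (\<exists>v. subseq v w \<and> sorted_wrt R v \<and> length v = k)"

text \<open>
  A coarsening of Knuth equivalence: no word context distinguishes the two words by the lengths of
  its longest monotone subsequences.
\<close>

definition knuth_eq :: "nat list \<Rightarrow> nat list \<Rightarrow> bool" where
  "knuth_eq w w' \<longleftrightarrow> (\<forall>u t k. chain (<) k (u @ w @ t) = chain (<) k (u @ w' @ t) \<and>
     chain (>) k (u @ w @ t) = chain (>) k (u @ w' @ t))"

lemma knuth_eq_refl: "knuth_eq w w"
  by (simp add: knuth_eq_def)

lemma knuth_eq_sym: "knuth_eq w w' \<Longrightarrow> knuth_eq w' w"
  by (simp add: knuth_eq_def)

lemma knuth_eq_trans [trans]: "knuth_eq w w' \<Longrightarrow> knuth_eq w' w'' \<Longrightarrow> knuth_eq w w''"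
  by (simp add: knuth_eq_def)

lemma knuth_eq_append_right:
  assumes "knuth_eq w w'"
  shows "knuth_eq (w @ t) (w' @ t)"
  unfolding knuth_eq_def
proof (intro allI)
  fix u s k
  show "chain (<) k (u @ (w @ t) @ s) = chain (<) k (u @ (w' @ t) @ s) \<and>
      chain (>) k (u @ (w @ t) @ s) = chain (>) k (u @ (w' @ t) @ s)"
    using assms[unfolded knuth_eq_def, rule_format, of k u "t @ s"] by simp
qed

lemma knuth_eq_append_left:
  assumes "knuth_eq w w'"
  shows "knuth_eq (u @ w) (u @ w')"
  unfolding knuth_eq_def
proof (intro allI)
  fix s t k
  show "chain (<) k (s @ (u @ w) @ t) = chain (<) k (s @ (u @ w') @ t) \<and>
      chain (>) k (s @ (u @ w) @ t) = chain (>) k (s @ (u @ w') @ t)"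
    using assms[unfolded knuth_eq_def, rule_format, of k "s @ u" t] by simp
qed

lemma knuth_eq_chain:
  assumes "knuth_eq w w'"
  shows "chain (<) k w = chain (<) k w'" "chain (>) k w = chain (>) k w'"
  using assms[unfolded knuth_eq_def, rule_format, of k "[]" "[]"] by simp_all

text \<open>A monotone subsequence of \<open>u @ w @ t\<close> meets \<open>w\<close> in a middle
  piece, and only this piece has to be replaced. The outer pieces constrain it only through the sets
  \<open>P\<close> and \<open>Q\<close> of letters to its left and right, so a Knuth move is
  verified on subwords of three letters.\<close>

lemma chain_append3_transfer:
  assumes "chain R k (u @ w @ t)"
    and "\<And>v P Q. subseq v w \<Longrightarrow> sorted_wrt R v \<Longrightarrow> \<forall>a\<in>P. \<forall>x\<in>set v. R a x \<Longrightarrow> \<forall>x\<in>set v. \<forall>b\<in>Q. R x b \<Longrightarrow>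
      \<exists>v'. subseq v' w' \<and> sorted_wrt R v' \<and> length v' = length v \<and>
        (\<forall>a\<in>P. \<forall>x\<in>set v'. R a x) \<and> (\<forall>x\<in>set v'. \<forall>b\<in>Q. R x b)"
  shows "chain R k (u @ w' @ t)"
proof -
  obtain z where z: "subseq z (u @ w @ t)" "sorted_wrt R z" "length z = k"
    using assms(1) by (auto simp: chain_def)
  then obtain v1 v v2 where v: "z = v1 @ v @ v2" "subseq v1 u" "subseq v w" "subseq v2 t"
    by (metis subseq_appendE)
  obtain v' where v': "subseq v' w'" "sorted_wrt R v'" "length v' = length v"
      "\<forall>a\<in>set v1. \<forall>x\<in>set v'. R a x" "\<forall>x\<in>set v'. \<forall>b\<in>set v2. R x b"
    using assms(2)[of v "set v1" "set v2"] z(2) v by (auto simp: sorted_wrt_append)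
  have "subseq (v1 @ v' @ v2) (u @ w' @ t)"
    using v v' by (intro list_emb_append_mono)
  moreover have "sorted_wrt R (v1 @ v' @ v2)"
    using z(2) v(1) v' by (auto simp: sorted_wrt_append)
  moreover have "length (v1 @ v' @ v2) = k"
    using z(3) v(1) v'(3) by simp
  ultimately show ?thesis unfolding chain_def by blast
qed

lemma subseq_iff_in_subseqs: "subseq v w \<longleftrightarrow> v \<in> set (subseqs w)"
  by simp

text \<open>Exchanging \<open>x\<close> and \<open>z\<close> destroys just two monotone subwords,
  the increasing \<open>[x, z]\<close> and the decreasing \<open>[z, x]\<close>. The witness
  \<open>y\<close> stands after both letters and lies between them in value, so it can replace the
  second letter in either case.\<close>

lemma knuth_move_left:
  assumes "x < y" "y < z"
  shows "knuth_eq [x, z, y] [z, x, y]"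
proof -
  have 1: "chain (<) k (u @ [z, x, y] @ t)" if "chain (<) k (u @ [x, z, y] @ t)" for u t k
  proof (rule chain_append3_transfer[OF that])
    fix v P Q assume v: "subseq v [x, z, y]" and a: "sorted_wrt (<) v" "\<forall>a\<in>P. \<forall>x\<in>set v. a < x" "\<forall>x\<in>set v. \<forall>b\<in>Q. x < b"
    have "v \<in> {[], [x], [z], [y], [x, z], [x, y], [z, y], [x, z, y]}"
      using v by (auto simp: subseq_iff_in_subseqs Let_def simp del: set_subseqs_eq)
    then show "\<exists>v'. subseq v' [z, x, y] \<and> sorted_wrt (<) v' \<and> length v' = length v \<and>
        (\<forall>a\<in>P. \<forall>x\<in>set v'. a < x) \<and> (\<forall>x\<in>set v'. \<forall>b\<in>Q. x < b)"
    proof (cases "v = [x, z]")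
      case True then show ?thesis using a assms by (intro exI[of _ "[x, y]"]) (force)
    next
      case False
      with \<open>v \<in> _\<close> show ?thesis using a assms by (intro exI[of _ v]) (auto)
    qed
  qed
  have 2: "chain (<) k (u @ [x, z, y] @ t)" if "chain (<) k (u @ [z, x, y] @ t)" for u t k
  proof (rule chain_append3_transfer[OF that])
    fix v P Q assume v: "subseq v [z, x, y]" and a: "sorted_wrt (<) v" "\<forall>a\<in>P. \<forall>x\<in>set v. a < x" "\<forall>x\<in>set v. \<forall>b\<in>Q. x < b"
    have "v \<in> {[], [z], [x], [y], [z, x], [x, y], [z, y], [z, x, y]}"
      using v by (auto simp: subseq_iff_in_subseqs Let_def simp del: set_subseqs_eq)
    then show "\<exists>v'. subseq v' [x, z, y] \<and> sorted_wrt (<) v' \<and> length v' = length v \<and>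
        (\<forall>a\<in>P. \<forall>x\<in>set v'. a < x) \<and> (\<forall>x\<in>set v'. \<forall>b\<in>Q. x < b)"
      using a assms by (intro exI[of _ v]) auto
  qed
  have 3: "chain (>) k (u @ [z, x, y] @ t)" if "chain (>) k (u @ [x, z, y] @ t)" for u t k
  proof (rule chain_append3_transfer[OF that])
    fix v P Q assume v: "subseq v [x, z, y]" and a: "sorted_wrt (>) v" "\<forall>a\<in>P. \<forall>x\<in>set v. a > x" "\<forall>x\<in>set v. \<forall>b\<in>Q. x > b"
    have "v \<in> {[], [x], [z], [y], [x, z], [x, y], [z, y], [x, z, y]}"
      using v by (auto simp: subseq_iff_in_subseqs Let_def simp del: set_subseqs_eq)
    then show "\<exists>v'. subseq v' [z, x, y] \<and> sorted_wrt (>) v' \<and> length v' = length v \<and>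
        (\<forall>a\<in>P. \<forall>x\<in>set v'. a > x) \<and> (\<forall>x\<in>set v'. \<forall>b\<in>Q. x > b)"
      using a assms by (intro exI[of _ v]) auto
  qed
  have 4: "chain (>) k (u @ [x, z, y] @ t)" if "chain (>) k (u @ [z, x, y] @ t)" for u t k
  proof (rule chain_append3_transfer[OF that])
    fix v P Q assume v: "subseq v [z, x, y]" and a: "sorted_wrt (>) v" "\<forall>a\<in>P. \<forall>x\<in>set v. a > x" "\<forall>x\<in>set v. \<forall>b\<in>Q. x > b"
    have "v \<in> {[], [z], [x], [y], [z, x], [x, y], [z, y], [z, x, y]}"
      using v by (auto simp: subseq_iff_in_subseqs Let_def simp del: set_subseqs_eq)
    then show "\<exists>v'. subseq v' [x, z, y] \<and> sorted_wrt (>) v' \<and> length v' = length v \<and>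
        (\<forall>a\<in>P. \<forall>x\<in>set v'. a > x) \<and> (\<forall>x\<in>set v'. \<forall>b\<in>Q. x > b)"
    proof (cases "v = [z, x]")
      case True then show ?thesis using a assms by (intro exI[of _ "[z, y]"]) force
    next
      case False
      with \<open>v \<in> _\<close> show ?thesis using a assms by (intro exI[of _ v]) auto
    qed
  qed
  show ?thesis unfolding knuth_eq_def using 1 2 3 4 by blast
qed

lemma subseq_rev: "subseq v w \<Longrightarrow> subseq (rev v) (rev w)"
  by (induction rule: list_emb.induct) (auto intro: subseq_rev_drop_many)

lemma chain_rev: "chain R k (rev w) \<longleftrightarrow> chain (\<lambda>a b. R b a) k w"
proof -
  have *: "chain (\<lambda>a b. Q b a) k (rev w)" if "chain Q k w" for Q w
    using that unfolding chain_def
    by (metis length_rev rev_rev_ident sorted_wrt_rev subseq_rev)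
  show ?thesis
    using *[of R "rev w"] *[of "\<lambda>a b. R b a" w] by auto
qed

lemma knuth_eq_rev:
  assumes "knuth_eq w w'"
  shows "knuth_eq (rev w) (rev w')"
  unfolding knuth_eq_def
proof (intro allI)
  fix u t :: "nat list" and k
  have "u @ rev v @ t = rev (rev t @ v @ rev u)" for v :: "nat list" by simp
  then show "chain (<) k (u @ rev w @ t) = chain (<) k (u @ rev w' @ t) \<and>
      chain (>) k (u @ rev w @ t) = chain (>) k (u @ rev w' @ t)"
    using assms by (simp only: chain_rev knuth_eq_def)
qed

text \<open>The second Knuth move is the first one read backwards.\<close>

lemma knuth_move_right:
  assumes "x < y" "y < z"
  shows "knuth_eq [y, z, x] [y, x, z]"
  using knuth_eq_rev[OF knuth_move_left[OF assms]] by (simp add: knuth_eq_sym)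

text \<open>The letter \<open>x\<close> travels left through \<open>b\<close> one letter at a time.
  The witness is the letter in front of the one being passed; it lies between the two in value
  because \<open>x < y\<close> and \<open>y # b\<close> increases.\<close>

lemma knuth_eq_shift_right:
  assumes "sorted_wrt (<) (y # b)" "x < y"
  shows "knuth_eq (y # b @ [x]) (y # x # b)"
  using assms
proof (induction b arbitrary: y)
  case Nil
  show ?case by (simp add: knuth_eq_refl)
next
  case (Cons c b)
  have "knuth_eq ([y] @ c # b @ [x]) ([y] @ c # x # b)"
    using Cons by (intro knuth_eq_append_left Cons.IH) auto
  also have "knuth_eq ([y, c, x] @ b) ([y, x, c] @ b)"
    using Cons by (intro knuth_eq_append_right knuth_move_right) auto
  then have "knuth_eq ([y] @ c # x # b) (y # x # c # b)" by simp
  finally show ?case by simp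
qed

text \<open>Here \<open>y\<close> travels left through \<open>a\<close>. The witness for passing a
  letter is the next letter of \<open>a @ [x]\<close>, which by then stands right behind
  \<open>y\<close>.\<close>

lemma knuth_eq_shift_left:
  assumes "sorted_wrt (<) (a @ [x])" "x < y"
  shows "knuth_eq (a @ [y, x]) (y # a @ [x])"
  using assms
proof (induction a)
  case Nil
  show ?case by (simp add: knuth_eq_refl)
next
  case (Cons c a)
  have *: "knuth_eq ([c] @ a @ [y, x]) ([c] @ y # a @ [x])"
    using Cons by (intro knuth_eq_append_left Cons.IH) auto
  obtain d e where de: "a @ [x] = d # e" by (cases a) auto
  have "c < d" using Cons.prems(1) de by (cases a) auto
  have "d < y" using Cons.prems de by (cases a) auto
  have "knuth_eq ([c, y, d] @ e) ([y, c, d] @ e)"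
    using \<open>c < d\<close> \<open>d < y\<close> by (intro knuth_eq_append_right knuth_move_left) auto
  then have "knuth_eq ([c] @ y # a @ [x]) (y # c # a @ [x])" using de by simp
  with * show ?case using knuth_eq_trans by fastforce
qed

text \<open>This is one bump, with \<open>y\<close> the bumped letter. Reading words list the rows
  from the bottom up, so \<open>y\<close> emerges just where it has to be inserted next, at the end
  of the rows below.\<close>

lemma knuth_eq_row_bump:
  assumes "sorted_wrt (<) (a @ y # b)" "sorted_wrt (<) (a @ [x])" "x < y"
  shows "knuth_eq (a @ y # b @ [x]) (y # a @ x # b)"
proof -
  have "knuth_eq (a @ y # b @ [x]) (a @ y # x # b)"
    using assms by (intro knuth_eq_append_left knuth_eq_shift_right) (auto simp: sorted_wrt_append)
  also have "knuth_eq ((a @ [y, x]) @ b) ((y # a @ [x]) @ b)"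
    using assms by (intro knuth_eq_append_right knuth_eq_shift_left)
  then have "knuth_eq (a @ y # x # b) (y # a @ x # b)" by simp
  finally show ?thesis .
qed

section \<open>Tableaux and row insertion\<close>

text \<open>
  A standard tableau is represented by the list of its rows, each row by its set of entries. For
  disjoint rows, dominance says that the columns increase.
\<close>

definition dominates :: "nat set \<Rightarrow> nat set \<Rightarrow> bool" where
  "dominates R R' \<longleftrightarrow> (\<forall>b. card (R' \<inter> {..<b}) \<le> card (R \<inter> {..<b}))"

fun row0 :: "nat set list \<Rightarrow> nat set" where
  "row0 [] = {}"
| "row0 (R # T) = R"

fun tab :: "nat set list \<Rightarrow> bool" where
  "tab [] \<longleftrightarrow> True"
| "tab (R # T) \<longleftrightarrow> finite R \<and> R \<noteq> {} \<and> R \<inter> \<Union>(set T) = {} \<and> dominates R (row0 T) \<and> tab T"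

definition bumps :: "nat \<Rightarrow> nat set \<Rightarrow> nat set" where
  "bumps x R = {y \<in> R. x < y}"

definition row_ins :: "nat \<Rightarrow> nat set \<Rightarrow> nat set" where
  "row_ins x R = (if bumps x R = {} then insert x R else insert x (R - {Min (bumps x R)}))"

fun ins :: "nat \<Rightarrow> nat set list \<Rightarrow> nat set list" where
  "ins x [] = [{x}]"
| "ins x (R # T) = row_ins x R # (if bumps x R = {} then T else ins (Min (bumps x R)) T)"

fun word :: "nat set list \<Rightarrow> nat list" where
  "word [] = []"
| "word (R # T) = word T @ sorted_list_of_set R"

lemma finite_bumps [simp]: "finite R \<Longrightarrow> finite (bumps x R)"
  by (simp add: bumps_def)

lemma Min_bumps:
  assumes "finite R" "bumps x R \<noteq> {}"
  shows "Min (bumps x R) \<in> R" "x < Min (bumps x R)" "\<And>z. z \<in> R \<Longrightarrow> x < z \<Longrightarrow> Min (bumps x R) \<le> z"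
  using Min_in[of "bumps x R"] assms by (auto simp: bumps_def)

lemma row0_ins: "row0 (ins x T) = row_ins x (row0 T)"
  by (cases T) (auto simp: row_ins_def bumps_def)

lemma finite_row0: "tab T \<Longrightarrow> finite (row0 T)"
  by (cases T) auto

lemma row0_subset: "row0 T \<subseteq> \<Union>(set T)"
  by (cases T) auto

lemma card_insert_below:
  assumes "finite R" "x \<notin> R"
  shows "card (insert x R \<inter> {..<b}) = card (R \<inter> {..<b}) + of_bool (x < b)"
  using assms by (auto simp: Int_insert_left)

lemma card_remove_below:
  assumes "finite R" "y \<in> R"
  shows "card ((R - {y}) \<inter> {..<b}) + of_bool (y < b) = card (R \<inter> {..<b})"
  using card_insert_below[of "R - {y}" y b] assms by (simp add: insert_absorb)

text \<open>A bump replaces an entry \<open>y\<close> by the smaller \<open>x\<close>, so the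
  counting function of the row rises by one exactly at the thresholds \<open>x < b \<le> y\<close>,
  and at all \<open>b > x\<close> if nothing is bumped. Dominance compares such counting
  functions.\<close>

lemma card_row_ins_below:
  assumes "finite R" "x \<notin> R"
  shows "card (row_ins x R \<inter> {..<b}) =
    card (R \<inter> {..<b}) + of_bool (x < b \<and> (\<forall>z\<in>R. x < z \<longrightarrow> b \<le> z))"
proof (cases "bumps x R = {}")
  case True
  then show ?thesis using assms card_insert_below[OF assms, of b]
    by (auto simp: row_ins_def bumps_def)
next
  case False
  note m = Min_bumps[OF assms(1) False]
  define y where "y = Min (bumps x R)"
  have "card (insert x (R - {y}) \<inter> {..<b}) = card ((R - {y}) \<inter> {..<b}) + of_bool (x < b)"
    using assms by (intro card_insert_below) auto
  moreover have "card ((R - {y}) \<inter> {..<b}) + of_bool (y < b) = card (R \<inter> {..<b})"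
    using assms m by (intro card_remove_below) (auto simp: y_def)
  moreover have "(\<forall>z\<in>R. x < z \<longrightarrow> b \<le> z) \<longleftrightarrow> b \<le> y"
    using m unfolding y_def by force
  moreover have "x < y" using m by (simp add: y_def)
  ultimately show ?thesis using False by (auto simp: row_ins_def y_def of_bool_def split: if_splits)
qed

lemma dominates_row_ins:
  assumes "finite R" "finite R1" "dominates R R1" "x \<notin> R" "x \<notin> R1"
  shows "dominates (row_ins x R) R1"
  using assms by (auto simp: dominates_def card_row_ins_below intro: le_SucI)

text \<open>The lower count grows only at a threshold \<open>b > y\<close> with no lower entry
  strictly between \<open>y\<close> and \<open>b\<close>. There the old lower count equals the one
  at \<open>y\<close>, hence is at most the number of upper entries below \<open>y\<close>, and
  \<open>y\<close> itself is one more upper entry below \<open>b\<close>. Replacing \<open>y\<close>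
  by \<open>x\<close> does not lower the upper count.\<close>

lemma dominates_row_ins_bumped:
  assumes "finite R" "finite R1" "dominates R R1" "x \<notin> R" "bumps x R \<noteq> {}" "Min (bumps x R) \<notin> R1"
  shows "dominates (row_ins x R) (row_ins (Min (bumps x R)) R1)"
  unfolding dominates_def
proof
  fix b
  define y where "y = Min (bumps x R)"
  note m = Min_bumps[OF assms(1,5), folded y_def]
  have 1: "card (row_ins x R \<inter> {..<b}) \<ge> card (R \<inter> {..<b})"
    using assms by (simp add: card_row_ins_below)
  have 2: "card (row_ins y R1 \<inter> {..<b}) =
      card (R1 \<inter> {..<b}) + of_bool (y < b \<and> (\<forall>z\<in>R1. y < z \<longrightarrow> b \<le> z))"
    using assms by (simp add: card_row_ins_below y_def)
  have "card (row_ins y R1 \<inter> {..<b}) \<le> card (R \<inter> {..<b})"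
  proof (cases "y < b \<and> (\<forall>z\<in>R1. y < z \<longrightarrow> b \<le> z)")
    case True
    then have "R1 \<inter> {..<b} = R1 \<inter> {..<y}"
      using assms(6) unfolding y_def[symmetric]
      by (intro equalityI subsetI) (auto, metis linorder_neqE_nat not_le)
    then have "card (R1 \<inter> {..<b}) \<le> card (R \<inter> {..<y})"
      using assms(3) by (simp add: dominates_def)
    also have "\<dots> < card (R \<inter> {..<b})"
      using True m assms(1) by (intro psubset_card_mono) auto
    finally show ?thesis using 2 True by simp
  next
    case False
    then show ?thesis using 2 assms(3) by (auto simp: dominates_def)
  qed
  then show "card (row_ins (Min (bumps x R)) R1 \<inter> {..<b}) \<le> card (row_ins x R \<inter> {..<b})"
    using 1 by (simp add: y_def)
qed

lemma finite_row_ins [simp]: "finite (row_ins x R) \<longleftrightarrow> finite R"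
  by (auto simp: row_ins_def)

lemma row_ins_nonempty [simp]: "row_ins x R \<noteq> {}"
  by (auto simp: row_ins_def)

lemma tab_ins_aux:
  assumes "tab T" "x \<notin> \<Union>(set T)"
  shows "tab (ins x T) \<and> \<Union>(set (ins x T)) = insert x (\<Union>(set T))"
  using assms
proof (induction T arbitrary: x)
  case Nil
  show ?case by (simp add: dominates_def)
next
  case (Cons R T)
  have x: "x \<notin> R" "x \<notin> row0 T" "x \<notin> \<Union>(set T)" using Cons.prems row0_subset by auto
  have fin: "finite R" "finite (row0 T)" "tab T" using Cons.prems finite_row0 by auto
  have dis: "R \<inter> \<Union>(set T) = {}" "dominates R (row0 T)" using Cons.prems by auto
  show ?case
  proof (cases "bumps x R = {}")
    case True
    have "dominates (row_ins x R) (row0 T)" using fin x dis by (intro dominates_row_ins) auto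
    then show ?thesis using True fin x dis by (auto simp: row_ins_def)
  next
    case False
    define y where "y = Min (bumps x R)"
    note m = Min_bumps[OF fin(1) False, folded y_def]
    have y: "y \<notin> \<Union>(set T)" using m dis by auto
    then have "y \<notin> row0 T" using row0_subset by blast
    have IH: "tab (ins y T)" "\<Union>(set (ins y T)) = insert y (\<Union>(set T))"
      using Cons.IH[OF fin(3) y] by auto
    have "dominates (row_ins x R) (row0 (ins y T))"
      unfolding row0_ins y_def
      using fin x dis False \<open>y \<notin> row0 T\<close> by (intro dominates_row_ins_bumped) (auto simp: y_def)
    moreover have r: "row_ins x R = insert x (R - {y})" using False by (simp add: row_ins_def y_def)
    ultimately have "tab (ins x (R # T))"
      using False IH fin x dis m(2) by (auto simp: y_def[symmetric])
    moreover have "\<Union>(set (ins x (R # T))) = insert x (\<Union>(set (R # T)))"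
      using False IH r m(1) by (auto simp: y_def[symmetric])
    ultimately show ?thesis by blast
  qed
qed

lemma tab_ins: "tab T \<Longrightarrow> x \<notin> \<Union>(set T) \<Longrightarrow> tab (ins x T)"
  and entries_ins: "tab T \<Longrightarrow> x \<notin> \<Union>(set T) \<Longrightarrow> \<Union>(set (ins x T)) = insert x (\<Union>(set T))"
  using tab_ins_aux by blast+

lemma sorted_list_of_set_eqI:
  "sorted_wrt (<) xs \<Longrightarrow> set xs = A \<Longrightarrow> sorted_list_of_set A = xs"
  by (metis sorted_list_of_set.idem_if_sorted_distinct strict_sorted_iff)

lemma knuth_eq_row_ins:
  assumes "finite R" "x \<notin> R" "bumps x R \<noteq> {}"
  shows "knuth_eq (sorted_list_of_set R @ [x]) (Min (bumps x R) # sorted_list_of_set (row_ins x R))"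
proof -
  define y where "y = Min (bumps x R)"
  note m = Min_bumps[OF assms(1,3), folded y_def]
  define a where "a = sorted_list_of_set {z \<in> R. z < x}"
  define b where "b = sorted_list_of_set {z \<in> R. y < z}"
  have s: "set a = {z \<in> R. z < x}" "set b = {z \<in> R. y < z}" "sorted_wrt (<) a" "sorted_wrt (<) b"
    using assms(1) by (auto simp: a_def b_def)
  have "z < x \<or> z = y \<or> y < z" if "z \<in> R" for z
    using m(3)[OF that] that assms(2) by (metis le_neq_implies_less nat_neq_iff)
  then have R: "R = {z \<in> R. z < x} \<union> {y} \<union> {z \<in> R. y < z}"
    using m(1) by auto
  have 1: "sorted_list_of_set R = a @ y # b"
    using s m R by (intro sorted_list_of_set_eqI) (auto simp: sorted_wrt_append)
  have 2: "sorted_list_of_set (row_ins x R) = a @ x # b"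
    using s m R assms(3) by (intro sorted_list_of_set_eqI) (auto simp: sorted_wrt_append row_ins_def y_def[symmetric])
  show ?thesis unfolding 1 2 y_def[symmetric]
    using knuth_eq_row_bump[of a y b x] s m by (auto simp: sorted_wrt_append)
qed

lemma knuth_eq_word_ins:
  assumes "tab T" "x \<notin> \<Union>(set T)"
  shows "knuth_eq (word T @ [x]) (word (ins x T))"
  using assms
proof (induction T arbitrary: x)
  case Nil
  show ?case by (simp add: knuth_eq_refl)
next
  case (Cons R T)
  show ?case
  proof (cases "bumps x R = {}")
    case True
    have "sorted_list_of_set (insert x R) = sorted_list_of_set R @ [x]"
      using True Cons.prems by (intro sorted_list_of_set_eqI)
        (auto simp: sorted_wrt_append bumps_def nat_neq_iff)
    then show ?thesis using True by (simp add: row_ins_def knuth_eq_refl)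
  next
    case False
    define y where "y = Min (bumps x R)"
    note m = Min_bumps[OF _ False, folded y_def]
    have "knuth_eq (word T @ sorted_list_of_set R @ [x]) (word T @ y # sorted_list_of_set (row_ins x R))"
      unfolding y_def using Cons.prems False by (intro knuth_eq_append_left knuth_eq_row_ins) auto
    also have "knuth_eq ((word T @ [y]) @ sorted_list_of_set (row_ins x R))
        (word (ins y T) @ sorted_list_of_set (row_ins x R))"
      using Cons.prems m by (intro knuth_eq_append_right Cons.IH) auto
    then have "knuth_eq (word T @ y # sorted_list_of_set (row_ins x R)) (word (ins x (R # T)))"
      using False by (simp add: y_def)
    finally show ?thesis by simp
  qed
qed

section \<open>Monotone subsequences of the reading word\<close>

lemma subseq_set: "subseq v w \<Longrightarrow> set v \<subseteq> set w"
  by (induction rule: list_emb.induct) auto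

lemma sorted_wrt_subseq: "subseq v w \<Longrightarrow> sorted_wrt R w \<Longrightarrow> sorted_wrt R v"
proof (induction rule: list_emb.induct)
  case (list_emb_Cons2 x y xs ys)
  then show ?case using subseq_set by auto
qed auto

text \<open>The bound \<open>b\<close> is what lets the induction run. The letters from the lower
  rows lie below the first letter \<open>m\<close> taken from the top row, so by dominance they are
  at most as many as the top entries below \<open>m\<close>; the remaining letters are top entries
  in \<open>{m..<b}\<close>.\<close>

lemma increasing_word_bound:
  assumes "tab T" "subseq v (word T)" "sorted_wrt (<) v" "set v \<subseteq> {..<b}"
  shows "length v \<le> card (row0 T \<inter> {..<b})"
  using assms
proof (induction T arbitrary: v b)
  case Nil
  then show ?case by simp
next
  case (Cons R T)
  obtain v1 v2 where v: "v = v1 @ v2" "subseq v1 (word T)" "subseq v2 (sorted_list_of_set R)"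
    using Cons.prems(2) subseq_appendE unfolding word.simps by metis
  have fin: "finite R" "dominates R (row0 T)" using Cons.prems by auto
  have sub: "set v2 \<subseteq> R" using subseq_set[OF v(3)] fin by simp
  show ?case
  proof (cases v2)
    case Nil
    have "length v1 \<le> card (row0 T \<inter> {..<b})"
      using Cons.prems v by (intro Cons.IH) (auto simp: sorted_wrt_append)
    then show ?thesis using fin Nil v(1) le_trans by (fastforce simp: dominates_def)
  next
    case (Cons m v3)
    have "set v1 \<subseteq> {..<m}" using \<open>sorted_wrt (<) v\<close> v Cons by (auto simp: sorted_wrt_append)
    then have "length v1 \<le> card (row0 T \<inter> {..<m})"
      using Cons.prems(1,3) Cons.IH v by (auto simp: sorted_wrt_append)
    also have "\<dots> \<le> card (R \<inter> {..<m})" using fin by (simp add: dominates_def)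
    finally have 1: "length v1 \<le> card (R \<inter> {..<m})" .
    have sv2: "sorted_wrt (<) v2" using Cons.prems(3) v by (simp add: sorted_wrt_append)
    have "length v2 = card (set v2)"
      using sv2 strict_sorted_iff distinct_card by metis
    also have "\<dots> \<le> card (R \<inter> {m..<b})"
      using sub sv2 Cons Cons.prems(4) v fin by (intro card_mono) (auto simp: order.strict_iff_order)
    finally have 2: "length v2 \<le> card (R \<inter> {m..<b})" .
    have "m < b" using Cons.prems(4) v Cons by auto
    then have "R \<inter> {..<b} = (R \<inter> {..<m}) \<union> (R \<inter> {m..<b})" by auto
    moreover have "card ((R \<inter> {..<m}) \<union> (R \<inter> {m..<b})) = card (R \<inter> {..<m}) + card (R \<inter> {m..<b})"
      using fin by (intro card_Un_disjoint) auto
    ultimately show ?thesis using 1 2 v(1) by simp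
  qed
qed

lemma chain_mono:
  assumes "chain R k w" "l \<le> k"
  shows "chain R l w"
proof -
  obtain v where v: "subseq v w" "sorted_wrt R v" "length v = k"
    using assms by (auto simp: chain_def)
  have "subseq (take l v) w"
    using v(1) by (meson subseq_order.trans prefix_imp_subseq take_is_prefix)
  then show ?thesis using v assms(2) by (auto simp: chain_def intro!: exI[of _ "take l v"] sorted_wrt_take)
qed

lemma increasing_chain_word:
  assumes "tab T"
  shows "chain (<) k (word T) \<longleftrightarrow> k \<le> card (row0 T)"
proof
  assume "chain (<) k (word T)"
  then obtain v where v: "subseq v (word T)" "sorted_wrt (<) v" "length v = k"
    by (auto simp: chain_def)
  have "set v \<subseteq> {..<Suc (Max (set v))}" by (auto simp: less_Suc_eq_le)
  then have "k \<le> card (row0 T \<inter> {..<Suc (Max (set v))})"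
    using increasing_word_bound[OF assms] v by auto
  also have "\<dots> \<le> card (row0 T)" using finite_row0[OF assms] by (intro card_mono) auto
  finally show "k \<le> card (row0 T)" .
next
  assume k: "k \<le> card (row0 T)"
  have "subseq (sorted_list_of_set (row0 T)) (word T)"
    by (cases T) (auto intro: subseq_drop_many)
  then have "chain (<) (card (row0 T)) (word T)"
    by (auto simp: chain_def intro!: exI[of _ "sorted_list_of_set (row0 T)"])
  then show "chain (<) k (word T)" using k chain_mono by blast
qed

text \<open>A row is read in increasing order, so a decreasing subsequence takes at most one letter
  from it.\<close>

lemma decreasing_word_bound:
  assumes "tab T" "subseq v (word T)" "sorted_wrt (>) v"
  shows "length v \<le> length T"
  using assms
proof (induction T arbitrary: v)
  case Nil
  then show ?case by simp
next
  case (Cons R T)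
  obtain v1 v2 where v: "v = v1 @ v2" "subseq v1 (word T)" "subseq v2 (sorted_list_of_set R)"
    using Cons.prems(2) subseq_appendE unfolding word.simps by metis
  have "length v1 \<le> length T" using Cons.prems Cons.IH v by (auto simp: sorted_wrt_append)
  moreover have "sorted_wrt (>) v2" using Cons.prems v by (auto simp: sorted_wrt_append)
  moreover have "sorted_wrt (<) v2"
    using v(3) strict_sorted_list_of_set by (rule sorted_wrt_subseq)
  ultimately have "length v2 \<le> 1"
    by (cases v2; cases "tl v2") auto
  then show ?case using \<open>length v1 \<le> length T\<close> v(1) by simp
qed

lemma dominates_below:
  assumes "dominates R R'" "finite R'" "y \<in> R'" "y \<notin> R"
  obtains e where "e \<in> R" "e < y"
proof -
  have "card (R' \<inter> {..<Suc y}) \<noteq> 0" using assms by auto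
  then have "card (R \<inter> {..<Suc y}) \<noteq> 0" using assms(1) unfolding dominates_def by (metis le_zero_eq)
  then obtain e where "e \<in> R" "e < Suc y" by (metis Int_iff card.empty equals0I lessThan_iff)
  then show ?thesis using assms(4) that by (metis less_SucE)
qed

text \<open>Going up from the bottom row, each step appends a smaller entry of the next row,
  provided by \<open>dominates_below\<close>. The last letter is kept in \<open>row0 T\<close> so
  that the step can be repeated.\<close>

lemma decreasing_word_exists:
  assumes "tab T" "T \<noteq> []"
  shows "\<exists>v y. subseq (v @ [y]) (word T) \<and> sorted_wrt (>) (v @ [y]) \<and> length (v @ [y]) = length T \<and> y \<in> row0 T"
  using assms
proof (induction T)
  case Nil
  then show ?case by simp
next
  case (Cons R T)
  show ?case
  proof (cases "T = []")
    case True
    obtain y where "y \<in> R" using Cons.prems by auto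
    then have "subseq [y] (word (R # T))" using True Cons.prems by (simp add: subseq_singleton_left)
    then show ?thesis using True \<open>y \<in> R\<close> by (intro exI[of _ "[]"] exI[of _ y]) simp
  next
    case False
    then obtain v y where v: "subseq (v @ [y]) (word T)" "sorted_wrt (>) (v @ [y])"
        "length (v @ [y]) = length T" "y \<in> row0 T"
      using Cons by auto
    have "y \<notin> R" using v(4) row0_subset Cons.prems by fastforce
    obtain e where e: "e \<in> R" "e < y"
      using dominates_below[of R "row0 T" y] v(4) \<open>y \<notin> R\<close> Cons.prems finite_row0 by auto
    have "subseq ((v @ [y]) @ [e]) (word (R # T))"
      unfolding word.simps using v(1) e Cons.prems
      by (intro list_emb_append_mono) (auto simp: subseq_singleton_left)
    then show ?thesis using v e
      by (intro exI[of _ "v @ [y]"] exI[of _ e]) (auto simp: sorted_wrt_append)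
  qed
qed

lemma decreasing_chain_word:
  assumes "tab T"
  shows "chain (>) k (word T) \<longleftrightarrow> k \<le> length T"
proof
  show "chain (>) k (word T) \<Longrightarrow> k \<le> length T"
    using decreasing_word_bound[OF assms] by (auto simp: chain_def)
next
  assume k: "k \<le> length T"
  have "chain (>) (length T) (word T)"
  proof (cases "T = []")
    case False
    then show ?thesis using decreasing_word_exists[OF assms] unfolding chain_def by metis
  qed (auto simp: chain_def)
  then show "chain (>) k (word T)" using k chain_mono by blast
qed

section \<open>Shapes of tableaux\<close>

text \<open>Cells are pairs of a row and a column, counted from 0. As a plain set, a shape is
  transposed by \<open>prod.swap\<close> and grows by \<open>insert\<close>.\<close>

definition dia :: "nat set list \<Rightarrow> (nat \<times> nat) set" where
  "dia T = {(i, c). i < length T \<and> c < card (T ! i)}"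

definition young :: "(nat \<times> nat) set \<Rightarrow> bool" where
  "young D \<longleftrightarrow> (\<forall>i c i' c'. (i, c) \<in> D \<longrightarrow> i' \<le> i \<longrightarrow> c' \<le> c \<longrightarrow> (i', c') \<in> D)"

lemma youngD: "young D \<Longrightarrow> (i, c) \<in> D \<Longrightarrow> i' \<le> i \<Longrightarrow> c' \<le> c \<Longrightarrow> (i', c') \<in> D"
  unfolding young_def by blast

lemma dia_Nil [simp]: "dia [] = {}"
  by (simp add: dia_def)

lemma zero_in_dia_Cons [simp]: "(0, c) \<in> dia (R # T) \<longleftrightarrow> c < card R"
  and Suc_in_dia_Cons [simp]: "(Suc i, c) \<in> dia (R # T) \<longleftrightarrow> (i, c) \<in> dia T"
  by (simp_all add: dia_def)

lemma zero_in_dia: "(0, c) \<in> dia T \<longleftrightarrow> c < card (row0 T)"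
  by (cases T) simp_all

lemma diagram_eqI:
  assumes "\<And>c. (0, c) \<in> D \<longleftrightarrow> (0, c) \<in> E" "\<And>i c. (Suc i, c) \<in> D \<longleftrightarrow> (Suc i, c) \<in> E"
  shows "D = (E :: (nat \<times> nat) set)"
proof (rule set_eqI)
  fix p :: "nat \<times> nat"
  show "p \<in> D \<longleftrightarrow> p \<in> E" using assms by (cases p; cases "fst p") auto
qed

lemma dia_Cons_eq_iff: "dia (R # T) = dia (R' # T') \<longleftrightarrow> card R = card R' \<and> dia T = dia T'"
proof
  assume eq: "dia (R # T) = dia (R' # T')"
  have "{c. (0, c) \<in> dia (R # T)} = {..<card R}" "{c. (0, c) \<in> dia (R' # T')} = {..<card R'}" by auto
  then have "card R = card R'" using eq by (metis card_lessThan)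
  moreover have "(i, c) \<in> dia T \<longleftrightarrow> (i, c) \<in> dia T'" for i c
    using eq by (metis Suc_in_dia_Cons)
  ultimately show "card R = card R' \<and> dia T = dia T'" by auto
qed (auto intro!: diagram_eqI)

lemma dia_eq_empty: "tab T \<Longrightarrow> dia T = {} \<longleftrightarrow> T = []"
proof (cases T)
  case (Cons R U)
  assume "tab T"
  then have "(0, 0) \<in> dia T" using Cons by (simp add: card_gt_0_iff)
  then show ?thesis using Cons by (metis empty_iff list.discI)
qed simp

lemma row0_eq_empty: "tab T \<Longrightarrow> row0 T = {} \<longleftrightarrow> T = []"
  by (cases T) auto

lemma dominates_card:
  assumes "dominates R R'" "finite R" "finite R'"
  shows "card R' \<le> card R"
proof -
  obtain b where b: "R' \<subseteq> {..<b}" using assms(3) finite_nat_set_iff_bounded by auto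
  have "card R' = card (R' \<inter> {..<b})" using b by (simp add: Int_absorb2)
  also have "\<dots> \<le> card (R \<inter> {..<b})" using assms(1) by (simp add: dominates_def)
  also have "\<dots> \<le> card R" using assms(2) by (intro card_mono) auto
  finally show ?thesis .
qed

lemma young_dia: "tab T \<Longrightarrow> young (dia T)"
proof (induction T)
  case Nil
  then show ?case by (simp add: young_def)
next
  case (Cons R T)
  have IH: "young (dia T)" using Cons by simp
  have le: "card (row0 T) \<le> card R" using Cons.prems finite_row0 by (auto intro: dominates_card)
  show ?case unfolding young_def
  proof (intro allI impI)
    fix i c i' c'
    assume *: "(i, c) \<in> dia (R # T)" "i' \<le> i" "c' \<le> c"
    show "(i', c') \<in> dia (R # T)"
    proof (cases i)
      case 0
      then show ?thesis using * by simp
    next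
      case (Suc m)
      then have m: "(m, c) \<in> dia T" using * by simp
      show ?thesis
      proof (cases i')
        case 0
        have "(0, c') \<in> dia T" using youngD[OF IH m] * by simp
        then show ?thesis using 0 le by (simp add: zero_in_dia)
      next
        case (Suc m')
        then show ?thesis using youngD[OF IH m, of m' c'] * \<open>i = Suc m\<close> by simp
      qed
    qed
  qed
qed

section \<open>Row insertion and removable corners\<close>

lemma card_row_ins:
  assumes "finite R" "x \<notin> R"
  shows "card (row_ins x R) = card R + of_bool (bumps x R = {})"
proof (cases "bumps x R = {}")
  case False
  have "card R > 0" using False assms(1) by (auto simp: bumps_def card_gt_0_iff)
  then show ?thesis using Min_bumps[OF assms(1) False] assms False
    by (simp add: row_ins_def)
qed (use assms in \<open>simp add: row_ins_def\<close>)

lemma dia_ins: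
  assumes "tab T" "x \<notin> \<Union>(set T)"
  shows "\<exists>c. c \<notin> dia T \<and> dia (ins x T) = insert c (dia T)"
  using assms
proof (induction T arbitrary: x)
  case Nil
  have "dia [{x}] = {(0, 0)}" by (intro diagram_eqI) auto
  then show ?case by auto
next
  case (Cons R T)
  have x: "finite R" "x \<notin> R" using Cons.prems by auto
  show ?case
  proof (cases "bumps x R = {}")
    case True
    then have "dia (ins x (R # T)) = insert (0, card R) (dia (R # T))"
      using card_row_ins[OF x] by (intro diagram_eqI) auto
    then show ?thesis by (intro exI[of _ "(0, card R)"]) simp
  next
    case False
    define y where "y = Min (bumps x R)"
    have "y \<notin> \<Union>(set T)" using Min_bumps[OF x(1) False] Cons.prems by (auto simp: y_def)
    then obtain i c where c: "(i, c) \<notin> dia T" "dia (ins y T) = insert (i, c) (dia T)"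
      using Cons.IH[of y] Cons.prems(1) by auto
    then have "dia (ins x (R # T)) = insert (Suc i, c) (dia (R # T))"
      using card_row_ins[OF x] False by (intro diagram_eqI) (auto simp: y_def[symmetric])
    then show ?thesis using c by (intro exI[of _ "(Suc i, c)"]) simp
  qed
qed

text \<open>A row grows exactly if nothing is bumped from it, so equal shapes before and equal
  tableaux after force both insertions to stop in the same row. From there they are undone
  upwards.\<close>

lemma ins_inj:
  assumes "tab T1" "x1 \<notin> \<Union>(set T1)" "tab T2" "x2 \<notin> \<Union>(set T2)"
    and "ins x1 T1 = ins x2 T2" "dia T1 = dia T2"
  shows "T1 = T2 \<and> x1 = x2"
  using assms
proof (induction T1 arbitrary: T2 x1 x2)
  case Nil
  then have "T2 = []" using dia_eq_empty[of T2] by simp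
  then show ?case using Nil.prems(5) by simp
next
  case (Cons R1 T1)
  have "T2 \<noteq> []" using dia_eq_empty[OF Cons.prems(1)] Cons.prems(6) by auto
  then obtain R2 T2' where T2: "T2 = R2 # T2'" by (cases T2) auto
  have f: "finite R1" "x1 \<notin> R1" "finite R2" "x2 \<notin> R2" using Cons.prems T2 by auto
  have c: "card R1 = card R2" "dia T1 = dia T2'" using Cons.prems(6) by (simp_all add: T2 dia_Cons_eq_iff)
  have r: "row_ins x1 R1 = row_ins x2 R2" using Cons.prems(5) T2 by simp
  then have "of_bool (bumps x1 R1 = {}) = (of_bool (bumps x2 R2 = {}) :: nat)"
    using card_row_ins[OF f(1,2)] card_row_ins[OF f(3,4)] c(1) by simp
  then have b: "bumps x1 R1 = {} \<longleftrightarrow> bumps x2 R2 = {}" by (simp only: of_bool_eq_iff)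
  show ?case
  proof (cases "bumps x1 R1 = {}")
    case True
    then have eq: "insert x1 R1 = insert x2 R2" "T1 = T2'" using b r Cons.prems(5) T2 by (auto simp: row_ins_def)
    \<comment> \<open>Nothing was bumped, so each inserted letter is the maximum of the common new
      row.\<close>
    have "\<forall>z\<in>R1. z \<le> x1" "\<forall>z\<in>R2. z \<le> x2" using True b by (auto simp: bumps_def not_less[symmetric])
    then have "x1 = x2" using eq(1) by (metis insert_iff order_antisym)
    then show ?thesis using eq f T2 by auto
  next
    case False
    note f1 = False and f2 = False[unfolded b]
    define y1 y2 where "y1 = Min (bumps x1 R1)" and "y2 = Min (bumps x2 R2)"
    note m1 = Min_bumps[OF f(1) f1, folded y1_def] and m2 = Min_bumps[OF f(3) f2, folded y2_def]
    have "ins y1 T1 = ins y2 T2'" using Cons.prems(5) T2 f1 f2 by (simp add: y1_def y2_def)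
    moreover have "y1 \<notin> \<Union>(set T1)" "y2 \<notin> \<Union>(set T2')"
      using Cons.prems(1,3) T2 m1(1) m2(1) by auto
    ultimately have IH: "T1 = T2'" "y1 = y2"
      using Cons.IH[of y1 T2' y2] Cons.prems(1,3) c T2 by auto
    have eq: "insert x1 (R1 - {y1}) = insert x2 (R2 - {y1})"
      using r f1 f2 by (simp add: row_ins_def y1_def[symmetric] y2_def[symmetric] IH)
    \<comment> \<open>The inserted letter is the largest entry of the new row below the bumped
      \<open>y1\<close>: a larger one would be an old entry and would have been bumped
      instead.\<close>
    have "x1 = x2"
    proof (rule ccontr)
      assume ne: "x1 \<noteq> x2"
      have "x1 \<in> R2" "x2 \<in> R1" using eq ne by auto
      then show False using m1 m2 ne IH by (metis linorder_neqE_nat not_le)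
    qed
    moreover have "R1 - {y1} = R2 - {y1}" using eq f \<open>x1 = x2\<close> insert_ident[of x1 "R1 - {y1}" "R2 - {y1}"] by auto
    then have "R1 = R2" using m1(1) m2(1) IH(2) by blast
    ultimately show ?thesis using IH T2 by simp
  qed
qed

lemma young_tail: "young D \<Longrightarrow> young {(i, c). (Suc i, c) \<in> D}"
  unfolding young_def by simp

text \<open>Converse of \<open>dominates_row_ins_bumped\<close>. Replacing \<open>x\<close> by
  \<open>y\<close> lowers the upper count only for \<open>x < b \<le> y\<close>, and by one. As
  \<open>R\<close> has no entry above \<open>x\<close> and up to \<open>y\<close>, its count there
  is the one at \<open>Suc y\<close>, where inserting \<open>y\<close> has raised the lower count by
  one; so \<open>Q\<close> leaves the required slack.\<close>

lemma dominates_unbump: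
  assumes "finite R" "x \<in> R" "y \<notin> R" "x < y" "\<And>z. z \<in> R \<Longrightarrow> z < y \<Longrightarrow> z \<le> x"
    and "finite Q" "y \<notin> Q" "dominates R (row_ins y Q)"
  shows "dominates (insert y (R - {x})) Q"
  unfolding dominates_def
proof
  fix b
  have "card (insert y (R - {x}) \<inter> {..<b}) = card ((R - {x}) \<inter> {..<b}) + of_bool (y < b)"
    using assms by (intro card_insert_below) auto
  moreover have "card ((R - {x}) \<inter> {..<b}) + of_bool (x < b) = card (R \<inter> {..<b})"
    using assms by (intro card_remove_below)
  ultimately have L: "card (insert y (R - {x}) \<inter> {..<b}) + of_bool (x < b \<and> b \<le> y) = card (R \<inter> {..<b})"
    using assms(4) by (auto simp: of_bool_def split: if_splits)
  have Q: "card (row_ins y Q \<inter> {..<c}) = card (Q \<inter> {..<c}) + of_bool (y < c \<and> (\<forall>z\<in>Q. y < z \<longrightarrow> c \<le> z))" for c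
    using card_row_ins_below[OF assms(6,7)] .
  have D: "card (row_ins y Q \<inter> {..<c}) \<le> card (R \<inter> {..<c})" for c
    using assms(8) by (simp add: dominates_def)
  show "card (Q \<inter> {..<b}) \<le> card (insert y (R - {x}) \<inter> {..<b})"
  proof (cases "x < b \<and> b \<le> y")
    case True
    have "card (Q \<inter> {..<b}) \<le> card (Q \<inter> {..<Suc y})"
      using True assms(6) by (intro card_mono) auto
    also have "\<dots> + 1 = card (row_ins y Q \<inter> {..<Suc y})" unfolding Q by auto
    then have "card (Q \<inter> {..<Suc y}) + 1 \<le> card (R \<inter> {..<Suc y})" using D[of "Suc y"] by simp
    moreover have "R \<inter> {..<Suc y} = R \<inter> {..<b}"
      using True assms(3,5) by (fastforce simp: less_Suc_eq)
    ultimately show ?thesis using L True by simp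
  next
    case False
    then show ?thesis using L D[of b] Q[of b] by (auto simp: of_bool_def)
  qed
qed

text \<open>Reverse insertion from the corner \<open>c\<close>. If \<open>c\<close> is in the first
  row, the maximum of this row is given up. Otherwise the rows below give up a letter
  \<open>y\<close>, which replaces the largest entry \<open>x\<close> of \<open>R\<close> below
  \<open>y\<close>, and \<open>x\<close> is given up in turn.\<close>

lemma ins_surj:
  assumes "tab S" "c \<in> dia S" "young (dia S - {c})"
  shows "\<exists>T x. tab T \<and> x \<notin> \<Union>(set T) \<and> ins x T = S \<and> dia T = dia S - {c}"
  using assms
proof (induction S arbitrary: c)
  case Nil
  then show ?case by simp
next
  case (Cons R S)
  have fin: "finite R" "R \<noteq> {}" "tab S" "R \<inter> \<Union>(set S) = {}" "dominates R (row0 S)"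
    using Cons.prems by auto
  obtain i m where c: "c = (i, m)" by (cases c)
  show ?case
  proof (cases i)
    case 0
    have m: "m < card R" using Cons.prems c 0 by simp
    \<comment> \<open>\<open>c\<close> ends its row: a cell to its right would remain after its
      removal and violate \<open>young\<close>.\<close>
    have "\<not> Suc m < card R"
    proof
      assume "Suc m < card R"
      then have "(0, Suc m) \<in> dia (R # S) - {c}" using c 0 by simp
      then have "(0, m) \<in> dia (R # S) - {c}" using youngD[OF Cons.prems(3)] by (meson le_SucI order_refl)
      then show False using c 0 by simp
    qed
    then have m': "card R = Suc m" using m by simp
    \<comment> \<open>Likewise no cell lies under \<open>c\<close>. The next row is thus strictly
      shorter than \<open>R\<close>, which pays for the loss of \<open>x\<close>.\<close>
    have le: "card (row0 S) \<le> m"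
    proof (rule ccontr)
      assume "\<not> card (row0 S) \<le> m"
      then have "(Suc 0, m) \<in> dia (R # S) - {c}" using c 0 by (simp add: zero_in_dia)
      then have "(0, m) \<in> dia (R # S) - {c}" using youngD[OF Cons.prems(3)] by blast
      then show False using c 0 by simp
    qed
    define x where "x = Max R"
    have x: "x \<in> R" "\<And>z. z \<in> R \<Longrightarrow> z \<le> x" using fin by (auto simp: x_def)
    \<comment> \<open>A row must not become empty. If it would, the whole tableau is a single cell
      and the preimage is the empty list.\<close>
    show ?thesis
    proof (cases "m = 0")
      case True
      then have "row0 S = {}" using le finite_row0[OF fin(3)] by simp
      then have "S = []" using row0_eq_empty fin by blast
      moreover have "R = {x}" using m' True x by (metis One_nat_def card_1_singletonE singletonD)
      moreover have "dia [{x}] - {(0, 0)} = {}" by (auto simp: dia_def)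
      ultimately show ?thesis using c 0 True by (intro exI[of _ "[]"] exI[of _ x]) auto
    next
      case False
      have "dominates (R - {x}) (row0 S)"
        unfolding dominates_def
      proof
        fix b
        have *: "card ((R - {x}) \<inter> {..<b}) + of_bool (x < b) = card (R \<inter> {..<b})"
          using card_remove_below[OF fin(1) x(1)] .
        show "card (row0 S \<inter> {..<b}) \<le> card ((R - {x}) \<inter> {..<b})"
        proof (cases "x < b")
          case True
          then have "R \<inter> {..<b} = R" using x(2) by force
          moreover have "card (row0 S \<inter> {..<b}) \<le> card (row0 S)"
            using finite_row0[OF fin(3)] by (intro card_mono) auto
          ultimately show ?thesis using * True le m' by simp
        next
          case False
          then show ?thesis using * fin(5) by (simp add: dominates_def)
        qed
      qed
      moreover have "card (R - {x}) = m" using m' x by simp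
      moreover from this have "R - {x} \<noteq> {}" using False card.empty by metis
      moreover have "bumps x (R - {x}) = {}" using x by (auto simp: bumps_def not_less)
      then have "ins x ((R - {x}) # S) = R # S" using x(1) by (auto simp: row_ins_def)
      moreover have "dia ((R - {x}) # S) = dia (R # S) - {c}"
        using c 0 m' \<open>card (R - {x}) = m\<close> by (intro diagram_eqI) auto
      ultimately show ?thesis using fin x
        by (intro exI[of _ "(R - {x}) # S"] exI[of _ x]) auto
    qed
  next
    case (Suc l)
    have eq: "{(a, b). (Suc a, b) \<in> dia (R # S) - {c}} = dia S - {(l, m)}" using c Suc by auto
    then have "young (dia S - {(l, m)})" using young_tail[OF Cons.prems(3)] by simp
    moreover have "(l, m) \<in> dia S" using Cons.prems(2) c Suc by simp
    ultimately obtain T y where T: "tab T" "y \<notin> \<Union>(set T)" "ins y T = S" "dia T = dia S - {(l, m)}"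
      using Cons.IH fin(3) by blast
    have S: "row0 S = row_ins y (row0 T)" using T(3) row0_ins by metis
    have ent: "\<Union>(set S) = insert y (\<Union>(set T))" using T entries_ins by metis
    then have yR: "y \<notin> R" using fin by auto
    have "y \<in> row0 S" unfolding S by (auto simp: row_ins_def)
    then obtain e where e: "e \<in> R" "e < y"
      using dominates_below fin finite_row0 yR by metis
    \<comment> \<open>This maximum exists: \<open>R\<close> dominates the row containing
      \<open>y\<close>, which provides the entry \<open>e < y\<close>.\<close>
    define x where "x = Max {z \<in> R. z < y}"
    have "x \<in> {z \<in> R. z < y}" unfolding x_def using e fin(1) by (intro Max_in) auto
    then have x: "x \<in> R" "x < y" by auto
    have x': "z \<le> x" if "z \<in> R" "z < y" for z unfolding x_def using that fin(1) by (intro Max_ge) auto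
    define Q where "Q = insert y (R - {x})"
    have "y \<notin> row0 T" using T(2) row0_subset by blast
    then have dom: "dominates Q (row0 T)"
      unfolding Q_def using fin x x' yR finite_row0[OF T(1)] S
      by (intro dominates_unbump) auto
    have "Min (bumps x Q) = y"
    proof (rule Min_eqI)
      show "y \<le> z" if "z \<in> bumps x Q" for z
        using that x'[of z] by (cases "z < y") (auto simp: Q_def bumps_def)
    qed (use fin(1) x in \<open>auto simp: Q_def bumps_def\<close>)
    moreover have "bumps x Q \<noteq> {}" using x by (auto simp: Q_def bumps_def)
    moreover have "insert x (Q - {y}) = R" using x yR by (auto simp: Q_def)
    ultimately have I: "ins x (Q # T) = R # S" using T by (simp add: row_ins_def)
    have "card Q = card R" using card.remove[OF fin(1) x(1)] fin(1) yR by (simp add: Q_def)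
    then have "dia (Q # T) = dia (R # S) - {c}" using T(4) c Suc by (intro diagram_eqI) auto
    moreover have "tab (Q # T)" using dom fin T ent by (auto simp: Q_def)
    moreover have "x \<notin> \<Union>(set (Q # T))" using x fin ent by (auto simp: Q_def)
    ultimately show ?thesis using I by blast
  qed
qed

text \<open>The shape of \<open>T\<close> forces both \<open>T\<close> and \<open>x\<close>, so the
  preimages of \<open>S\<close> correspond to the removable corners of its shape. Nothing but the
  shape enters, hence the preimages of two tableaux of transposed shapes can be matched.\<close>

lemma bij_betw_ins:
  assumes "tab S"
  shows "bij_betw (dia \<circ> fst) {(T, x). tab T \<and> x \<notin> \<Union>(set T) \<and> ins x T = S}
    {D. young D \<and> (\<exists>c. c \<notin> D \<and> dia S = insert c D)}"
  unfolding bij_betw_def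
proof
  show "inj_on (dia \<circ> fst) {(T, x). tab T \<and> x \<notin> \<Union>(set T) \<and> ins x T = S}"
    using ins_inj by (auto simp: inj_on_def)
  show "(dia \<circ> fst) ` {(T, x). tab T \<and> x \<notin> \<Union>(set T) \<and> ins x T = S} =
    {D. young D \<and> (\<exists>c. c \<notin> D \<and> dia S = insert c D)}" (is "?L = ?R")
  proof
    show "?L \<subseteq> ?R" using dia_ins young_dia by (auto simp: image_subset_iff)
    show "?R \<subseteq> ?L"
    proof
      fix D assume "D \<in> ?R"
      then obtain c where D: "young D" "c \<notin> D" "dia S = insert c D" by auto
      then have eq: "D = dia S - {c}" by auto
      have "c \<in> dia S" using D(3) by simp
      then obtain T x where "tab T" "x \<notin> \<Union>(set T)" "ins x T = S" "dia T = D"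
        using ins_surj[OF assms _ D(1)[unfolded eq]] eq by metis
      then show "D \<in> ?L" by (intro image_eqI[of _ _ "(T, x)"]) auto
    qed
  qed
qed

section \<open>Removing the largest entry\<close>

text \<open>The restriction stops at the first row without entries below \<open>t\<close>. For a
  tableau the rows under it have none either, by \<open>entries_below_empty\<close>, so nothing is
  lost and no empty row is produced.\<close>

fun res :: "nat \<Rightarrow> nat set list \<Rightarrow> nat set list" where
  "res t [] = []"
| "res t (R # T) = (if R \<inter> {..<t} = {} then [] else (R \<inter> {..<t}) # res t T)"

lemma row0_res: "row0 (res t T) = row0 T \<inter> {..<t}"
  by (cases T) auto

lemma entries_below_empty:
  assumes "tab T" "row0 T \<inter> {..<t} = {}"
  shows "\<Union>(set T) \<inter> {..<t} = {}"
  using assms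
proof (induction T)
  case (Cons R T)
  have "dominates R (row0 T)" using Cons.prems by simp
  then have "card (row0 T \<inter> {..<t}) \<le> card (R \<inter> {..<t})" unfolding dominates_def by blast
  also have "\<dots> = 0" using Cons.prems by simp
  finally have "row0 T \<inter> {..<t} = {}" using finite_row0[of T] Cons.prems by simp
  then have "\<Union>(set T) \<inter> {..<t} = {}" using Cons by simp
  then show ?case using Cons.prems(2) by auto
qed simp

lemma entries_res: "tab T \<Longrightarrow> \<Union>(set (res t T)) = \<Union>(set T) \<inter> {..<t}"
proof (induction T)
  case (Cons R T)
  show ?case
  proof (cases "R \<inter> {..<t} = {}")
    case True
    then show ?thesis using entries_below_empty[OF Cons.prems, of t] by simp
  next
    case False
    then show ?thesis using Cons by auto
  qed
qed simp

lemma res_id: "tab T \<Longrightarrow> \<Union>(set T) \<subseteq> {..<t} \<Longrightarrow> res t T = T"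
proof (induction T)
  case (Cons R T)
  have "R \<inter> {..<t} = R" using Cons.prems by auto
  then show ?case using Cons by auto
qed simp

text \<open>All letters bumped in turn are even larger than \<open>x\<close>, so no entry below
  \<open>t\<close> moves.\<close>

lemma res_ins_ge:
  assumes "tab T" "x \<notin> \<Union>(set T)" "t \<le> x"
  shows "res t (ins x T) = res t T"
  using assms
proof (induction T arbitrary: x)
  case (Cons R T)
  show ?case
  proof (cases "bumps x R = {}")
    case True
    have "insert x R \<inter> {..<t} = R \<inter> {..<t}" using Cons.prems by auto
    then show ?thesis using True by (simp add: row_ins_def)
  next
    case False
    define y where "y = Min (bumps x R)"
    have m: "y \<in> R" "x < y" using Min_bumps[OF _ False] Cons.prems by (auto simp: y_def)
    have "insert x (R - {y}) \<inter> {..<t} = R \<inter> {..<t}" using Cons.prems m by auto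
    moreover have "res t (ins y T) = res t T" using Cons.prems m by (intro Cons.IH) auto
    ultimately show ?thesis using False by (simp add: row_ins_def y_def[symmetric])
  qed
qed simp

text \<open>A bump takes the smallest larger entry, so an entry \<open>\<ge> t\<close> is bumped
  only where no candidate below \<open>t\<close> exists. Up to that row both insertions agree. There
  the restricted one stops, while the full one goes on among large entries only, which
  \<open>res_ins_ge\<close> makes invisible.\<close>

lemma res_ins_less:
  assumes "tab T" "x \<notin> \<Union>(set T)" "x < t"
  shows "res t (ins x T) = ins x (res t T)"
  using assms
proof (induction T arbitrary: x)
  case (Cons R T)
  have fin: "finite R" "tab T" using Cons.prems by auto
  have below: "\<Union>(set T) \<inter> {..<t} = {}" if "R \<inter> {..<t} = {}"
    using entries_below_empty[OF Cons.prems(1), of t] that by auto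
  have res_empty: "res t T = []" if "R \<inter> {..<t} = {}"
    using below[OF that] by (cases T) auto
  show ?case
  proof (cases "bumps x (R \<inter> {..<t}) = {}")
    case True
    have rest: "res t (if bumps x R = {} then T else ins (Min (bumps x R)) T) = res t T"
    proof (cases "bumps x R = {}")
      case False
      note m = Min_bumps[OF fin(1) False]
      have "t \<le> Min (bumps x R)" using m(1,2) True by (force simp: bumps_def not_less[symmetric])
      moreover have "Min (bumps x R) \<notin> \<Union>(set T)" using m(1) Cons.prems by auto
      ultimately show ?thesis using False fin by (simp add: res_ins_ge)
    qed simp
    have row: "row_ins x R \<inter> {..<t} = insert x (R \<inter> {..<t})"
    proof (cases "bumps x R = {}")
      case False
      note m = Min_bumps[OF fin(1) False]
      have "t \<le> Min (bumps x R)" using m(1,2) True by (force simp: bumps_def not_less[symmetric])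
      then show ?thesis using False Cons.prems(3) by (auto simp: row_ins_def)
    qed (use Cons.prems(3) in \<open>auto simp: row_ins_def\<close>)
    show ?thesis
    proof (cases "R \<inter> {..<t} = {}")
      case e: True
      then show ?thesis using row rest res_empty by simp
    next
      case False
      then show ?thesis using row rest True by (simp add: row_ins_def[of x "R \<inter> {..<t}"])
    qed
  next
    case False
    then have False': "bumps x R \<noteq> {}" by (auto simp: bumps_def)
    define y where "y = Min (bumps x R)"
    note m = Min_bumps[OF fin(1) False', folded y_def]
    have "y < t" using False m by (force simp: bumps_def)
    have "Min (bumps x (R \<inter> {..<t})) = y"
      using m \<open>y < t\<close> fin(1) by (intro Min_eqI) (auto simp: bumps_def)
    moreover have "row_ins x R \<inter> {..<t} = insert x ((R \<inter> {..<t}) - {y})"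
      using False' Cons.prems(3) by (auto simp: row_ins_def y_def[symmetric])
    moreover have "res t (ins y T) = ins y (res t T)"
      using Cons.prems m(1) \<open>y < t\<close> by (intro Cons.IH) auto
    moreover have "R \<inter> {..<t} \<noteq> {}" using m(1) \<open>y < t\<close> by auto
    ultimately show ?thesis using False False'
      by (simp add: row_ins_def[of x "R \<inter> {..<t}"] y_def[symmetric])
  qed
qed simp

lemma tab_top_singleton:
  assumes "tab (R # T)" "\<Union>(set T) \<subseteq> {..t}" "R = {t}"
  shows "T = []"
proof (rule ccontr)
  assume "T \<noteq> []"
  then obtain y where y: "y \<in> row0 T" using assms(1) row0_eq_empty[of T] by auto
  then have "y \<notin> R" "y \<le> t" using assms row0_subset by fastforce+
  then show False using dominates_below[of R "row0 T" y] y assms finite_row0[of T] by auto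
qed

text \<open>The rows agree below \<open>t\<close>, and their lengths tell which one contains
  \<open>t\<close>.\<close>

lemma res_inj:
  assumes "tab S1" "tab S2" "\<Union>(set S1) \<subseteq> {..t}" "\<Union>(set S2) \<subseteq> {..t}"
    and "res t S1 = res t S2" "dia S1 = dia S2"
  shows "S1 = S2"
  using assms
proof (induction S1 arbitrary: S2)
  case Nil
  then show ?case using dia_eq_empty[of S2] by simp
next
  case (Cons R1 S1)
  have "S2 \<noteq> []" using dia_eq_empty[OF Cons.prems(1)] Cons.prems(6) by auto
  then obtain R2 S2' where S2: "S2 = R2 # S2'" by (cases S2) auto
  have c: "card R1 = card R2" "dia S1 = dia S2'" using Cons.prems(6) by (simp_all add: S2 dia_Cons_eq_iff)
  have sub: "R1 \<subseteq> {..t}" "R2 \<subseteq> {..t}" "\<Union>(set S1) \<subseteq> {..t}" "\<Union>(set S2') \<subseteq> {..t}"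
    using Cons.prems S2 by auto
  have tabs: "finite R1" "R1 \<noteq> {}" "finite R2" "R2 \<noteq> {}" "tab S1" "tab S2'" using Cons.prems S2 by auto
  have e: "R1 \<inter> {..<t} = R2 \<inter> {..<t}"
    using Cons.prems(5) S2 by (auto split: if_splits)
  have dec: "R = (R \<inter> {..<t}) \<union> (if t \<in> R then {t} else {})" if "R \<subseteq> {..t}" for R
    using that by (auto simp: order_le_less)
  have cd: "card R = card (R \<inter> {..<t}) + of_bool (t \<in> R)" if "R \<subseteq> {..t}" "finite R" for R
  proof (cases "t \<in> R")
    case True
    then have "R \<inter> {..<t} = R - {t}" using that(1) by (auto simp: order_le_less)
    then show ?thesis using card.remove[OF that(2) True] True by simp
  next
    case False
    then show ?thesis using dec[OF that(1)] by simp
  qed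
  have "t \<in> R1 \<longleftrightarrow> t \<in> R2"
    using cd[OF sub(1) tabs(1)] cd[OF sub(2) tabs(3)] c(1) e
    by (metis add_left_cancel of_bool_eq_iff)
  then have R: "R1 = R2" using dec[OF sub(1)] dec[OF sub(2)] e by metis
  show ?case
  proof (cases "R1 \<inter> {..<t} = {}")
    case True
    \<comment> \<open>\<open>res\<close> stops at a row that consists of \<open>t\<close> alone and
      says nothing about the rows below, but nothing can lie under the largest entry.\<close>
    then have "R1 = {t}" using dec[OF sub(1)] tabs by (auto split: if_splits)
    then have "S1 = []" "S2' = []"
      using tab_top_singleton[of R1 S1 t] tab_top_singleton[of R2 S2' t] Cons.prems(1,2) S2 sub R by auto
    then show ?thesis using R S2 by simp
  next
    case False
    then have "res t S1 = res t S2'" using Cons.prems(5) S2 e by auto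
    then have "S1 = S2'" using tabs sub c by (intro Cons.IH) auto
    then show ?thesis using R S2 by simp
  qed
qed

lemma dia_res:
  assumes "tab S" "t \<in> \<Union>(set S)" "\<Union>(set S) \<subseteq> {..t}"
  shows "\<exists>c. c \<notin> dia (res t S) \<and> dia S = insert c (dia (res t S))"
  using assms
proof (induction S)
  case Nil
  then show ?case by simp
next
  case (Cons R S)
  have fin: "finite R" "R \<noteq> {}" "tab S" "R \<inter> \<Union>(set S) = {}" "R \<subseteq> {..t}" "\<Union>(set S) \<subseteq> {..t}"
    using Cons.prems by auto
  show ?case
  proof (cases "t \<in> R")
    case True
    have R: "R \<inter> {..<t} = R - {t}" using fin(5) by (auto simp: order_le_less)
    have "\<Union>(set S) \<subseteq> {..<t}"
    proof
      fix z assume "z \<in> \<Union>(set S)"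
      then have "z \<le> t" "z \<noteq> t" using fin True by auto
      then show "z \<in> {..<t}" by simp
    qed
    then have S: "res t S = S" using fin by (simp add: res_id)
    have card: "card R = Suc (card (R - {t}))" using fin(1) True by (rule card.remove)
    show ?thesis
    proof (cases "R - {t} = {}")
      case e: True
      then have "R = {t}" using True by auto
      moreover have "S = []" using tab_top_singleton[OF Cons.prems(1) fin(6)] \<open>R = {t}\<close> by blast
      moreover have "dia [{t}] = {(0, 0)}" by (intro diagram_eqI) auto
      ultimately show ?thesis by auto
    next
      case False
      have "dia (R # S) = insert (0, card (R - {t})) (dia ((R - {t}) # S))"
        using card by (intro diagram_eqI) auto
      then show ?thesis using False R S by (intro exI[of _ "(0, card (R - {t}))"]) simp
    qed
  next
    case False
    have R: "R \<inter> {..<t} = R" using fin(5) False by (auto simp: order_le_less)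
    obtain i m where c: "(i, m) \<notin> dia (res t S)" "dia S = insert (i, m) (dia (res t S))"
      using Cons.IH fin Cons.prems(2) False by auto
    have "dia (R # S) = insert (Suc i, m) (dia (R # res t S))"
      by (intro diagram_eqI) (auto simp: c(2))
    then show ?thesis using R c(1) fin(2) by (intro exI[of _ "(Suc i, m)"]) simp
  qed
qed

text \<open>Writing the largest letter \<open>t\<close> into an addable cell keeps dominance.
  Thresholds \<open>b \<le> t\<close> do not see it; beyond \<open>t\<close> an upper row without
  \<open>t\<close> is counted in full, so it suffices to compare row lengths, and
  \<open>young\<close> does this.\<close>

lemma res_surj:
  assumes "tab T" "\<Union>(set T) \<subseteq> {..<t}" "c \<notin> dia T" "young (insert c (dia T))"
  shows "\<exists>S. tab S \<and> \<Union>(set S) = insert t (\<Union>(set T)) \<and> res t S = T \<and> dia S = insert c (dia T)"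
  using assms
proof (induction T arbitrary: c)
  case Nil
  obtain i m where c: "c = (i, m)" by (cases c)
  have "(0, 0) \<in> insert c (dia [])" using youngD[OF Nil(4), of i m 0 0] c by simp
  then have "c = (0, 0)" by simp
  moreover have "dia [{t}] = {(0, 0)}" by (intro diagram_eqI) auto
  ultimately show ?case by (intro exI[of _ "[{t}]"]) (simp add: dominates_def)
next
  case (Cons R T)
  have fin: "finite R" "R \<noteq> {}" "tab T" "R \<inter> \<Union>(set T) = {}" "R \<subseteq> {..<t}" "\<Union>(set T) \<subseteq> {..<t}"
      "dominates R (row0 T)"
    using Cons.prems by auto
  have tR: "t \<notin> R" "t \<notin> \<Union>(set T)" using fin(5,6) by auto
  have R: "R \<inter> {..<t} = R" using fin(5) by auto
  obtain i m where c: "c = (i, m)" by (cases c)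
  show ?case
  proof (cases i)
    case 0
    have "m \<ge> card R" using Cons.prems(3) c 0 by simp
    moreover have "(0, card R) \<in> insert c (dia (R # T))"
      using youngD[OF Cons.prems(4), of 0 m 0 "card R"] calculation c 0 by simp
    then have "card R = m" using c by simp
    moreover have "dia (insert t R # T) = insert (0, card R) (dia (R # T))"
      using tR fin(1) by (intro diagram_eqI) auto
    moreover have "dominates (insert t R) (row0 T)"
      using fin(7) card_insert_below[OF fin(1) tR(1)] by (auto simp: dominates_def intro: le_SucI)
    moreover have "insert t R \<inter> {..<t} = R" using R by auto
    ultimately show ?thesis using c 0 fin tR res_id[OF fin(3,6)]
      by (intro exI[of _ "insert t R # T"]) auto
  next
    case (Suc l)
    have eq: "{(a, b). (Suc a, b) \<in> insert c (dia (R # T))} = insert (l, m) (dia T)" using c Suc by auto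
    then have "young (insert (l, m) (dia T))" using young_tail[OF Cons.prems(4)] by simp
    moreover have "(l, m) \<notin> dia T" using Cons.prems(3) c Suc by simp
    ultimately obtain S where S: "tab S" "\<Union>(set S) = insert t (\<Union>(set T))" "res t S = T"
        "dia S = insert (l, m) (dia T)"
      using Cons.IH fin by blast
    have dR: "dia (R # S) = insert c (dia (R # T))"
      using c Suc S(4) by (intro diagram_eqI) auto
    have le: "card (row0 S) \<le> card R"
    proof (rule ccontr)
      assume "\<not> card (row0 S) \<le> card R"
      then have "(Suc 0, card R) \<in> dia (R # S)" by (simp add: zero_in_dia)
      then have "(0, card R) \<in> dia (R # S)" using youngD[OF Cons.prems(4)] dR by (metis le0 order_refl)
      then show False by simp
    qed
    have "dominates R (row0 S)"
      unfolding dominates_def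
    proof
      fix b
      show "card (row0 S \<inter> {..<b}) \<le> card (R \<inter> {..<b})"
      proof (cases "b \<le> t")
        case True
        have "row0 S \<inter> {..<b} = (row0 S \<inter> {..<t}) \<inter> {..<b}" using True by auto
        also have "row0 S \<inter> {..<t} = row0 T" using row0_res S(3) by metis
        finally show ?thesis using fin(7) by (simp add: dominates_def)
      next
        case False
        then have "R \<inter> {..<b} = R" using fin(5) by auto
        moreover have "card (row0 S \<inter> {..<b}) \<le> card (row0 S)"
          using finite_row0[OF S(1)] by (intro card_mono) auto
        ultimately show ?thesis using le by simp
      qed
    qed
    then have "tab (R # S)" using fin S tR by auto
    moreover have "res t (R # S) = R # T" using R fin(2) S(3) by simp
    ultimately show ?thesis using dR S(2) by (intro exI[of _ "R # S"]) auto
  qed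
qed

text \<open>Counterpart of \<open>bij_betw_ins\<close> for openers: the ways to restore
  \<open>t\<close> correspond to the addable cells of the shape of \<open>T\<close>.\<close>

lemma bij_betw_res:
  assumes "tab T" "\<Union>(set T) \<subseteq> {..<t}"
  shows "bij_betw dia {S. tab S \<and> \<Union>(set S) = insert t (\<Union>(set T)) \<and> res t S = T}
    {D. young D \<and> (\<exists>c. c \<notin> dia T \<and> D = insert c (dia T))}"
  unfolding bij_betw_def
proof
  have le: "insert t (\<Union>(set T)) \<subseteq> {..t}" using assms(2) by auto
  show "inj_on dia {S. tab S \<and> \<Union>(set S) = insert t (\<Union>(set T)) \<and> res t S = T}"
  proof (rule inj_onI)
    fix S1 S2 assume *: "S1 \<in> {S. tab S \<and> \<Union>(set S) = insert t (\<Union>(set T)) \<and> res t S = T}"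
      "S2 \<in> {S. tab S \<and> \<Union>(set S) = insert t (\<Union>(set T)) \<and> res t S = T}" "dia S1 = dia S2"
    then show "S1 = S2" using le by (intro res_inj[of S1 S2 t]) simp_all
  qed
  show "dia ` {S. tab S \<and> \<Union>(set S) = insert t (\<Union>(set T)) \<and> res t S = T} =
    {D. young D \<and> (\<exists>c. c \<notin> dia T \<and> D = insert c (dia T))}" (is "?L = ?R")
  proof
    show "?L \<subseteq> ?R"
    proof
      fix D assume "D \<in> ?L"
      then obtain S where S: "tab S" "\<Union>(set S) = insert t (\<Union>(set T))" "res t S = T" "D = dia S" by auto
      then show "D \<in> ?R" using dia_res[of S t] le young_dia[of S] by simp
    qed
    show "?R \<subseteq> ?L"
    proof
      fix D assume "D \<in> ?R"
      then obtain c where D: "young D" "c \<notin> dia T" "D = insert c (dia T)" by auto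
      then obtain S where "tab S" "\<Union>(set S) = insert t (\<Union>(set T))" "res t S = T" "dia S = D"
        using res_surj[OF assms D(2)] by metis
      then show "D \<in> ?L" by blast
    qed
  qed
qed

section \<open>Matchings as walks on tableaux\<close>

text \<open>The insertion tableau of the Robinson-Schensted correspondence.\<close>

definition ptab :: "nat list \<Rightarrow> nat set list" where
  "ptab w = fold ins w []"

lemma ptab_Nil [simp]: "ptab [] = []"
  and ptab_snoc [simp]: "ptab (w @ [x]) = ins x (ptab w)"
  by (simp_all add: ptab_def)

lemma ptab_aux:
  assumes "distinct w"
  shows "tab (ptab w) \<and> \<Union>(set (ptab w)) = set w \<and> knuth_eq w (word (ptab w))"
  using assms
proof (induction w rule: rev_induct)
  case Nil
  show ?case by (simp add: knuth_eq_refl)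
next
  case (snoc x w)
  then have IH: "tab (ptab w)" "\<Union>(set (ptab w)) = set w" "knuth_eq w (word (ptab w))"
    and x: "x \<notin> \<Union>(set (ptab w))" by auto
  have "knuth_eq (w @ [x]) (word (ptab w) @ [x])" using IH(3) by (rule knuth_eq_append_right)
  also have "knuth_eq \<dots> (word (ins x (ptab w)))" using IH(1) x by (rule knuth_eq_word_ins)
  finally show ?case using tab_ins[OF IH(1) x] entries_ins[OF IH(1) x] IH(2) by simp
qed

lemma tab_ptab: "distinct w \<Longrightarrow> tab (ptab w)"
  and entries_ptab: "distinct w \<Longrightarrow> \<Union>(set (ptab w)) = set w"
  and knuth_eq_ptab: "distinct w \<Longrightarrow> knuth_eq w (word (ptab w))"
  using ptab_aux by blast+

text \<open>At an opener \<open>t\<close> the letter \<open>t\<close> disappears from somewhere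
  inside the open word. Row insertion commutes with restriction to small letters, so on the tableau
  this is \<open>res t\<close>.\<close>

lemma ptab_filter: "distinct w \<Longrightarrow> ptab (filter (\<lambda>i. i < t) w) = res t (ptab w)"
proof (induction w rule: rev_induct)
  case (snoc x w)
  have "x \<notin> \<Union>(set (ptab w))" "tab (ptab w)" using snoc.prems by (auto simp: entries_ptab tab_ptab)
  then show ?case using snoc by (auto simp: res_ins_less res_ins_ge)
qed simp

definition shape_ok :: "nat \<Rightarrow> nat \<Rightarrow> (nat \<times> nat) set \<Rightarrow> bool" where
  "shape_ok j k D \<longleftrightarrow> card {c. (0, c) \<in> D} < j \<and> card {i. (i, 0) \<in> D} < k"

lemma shape_ok_swap: "shape_ok k j (prod.swap ` D) = shape_ok j k D"
proof -
  have "(a, b) \<in> prod.swap ` D \<longleftrightarrow> (b, a) \<in> D" for a b by force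
  then show ?thesis by (auto simp: shape_ok_def)
qed

lemma shape_ok_dia:
  assumes "tab T"
  shows "shape_ok j k (dia T) \<longleftrightarrow> card (row0 T) < j \<and> length T < k"
proof -
  have "{c. (0, c) \<in> dia T} = {..<card (row0 T)}" by (auto simp: zero_in_dia)
  moreover have "(i, 0) \<in> dia T \<longleftrightarrow> i < length T" for i
    using assms
  proof (induction T arbitrary: i)
    case (Cons R T)
    then show ?case by (cases i) (auto simp: card_gt_0_iff)
  qed simp
  then have "{i. (i, 0) \<in> dia T} = {..<length T}" by auto
  ultimately show ?thesis by (simp add: shape_ok_def)
qed

lemma shape_ok_ptab:
  assumes "distinct w"
  shows "shape_ok j k (dia (ptab w)) \<longleftrightarrow> \<not> chain (<) j w \<and> \<not> chain (>) k w"
  using knuth_eq_chain[OF knuth_eq_ptab[OF assms]] shape_ok_dia[OF tab_ptab[OF assms]]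
    increasing_chain_word[OF tab_ptab[OF assms]] decreasing_chain_word[OF tab_ptab[OF assms]]
  by (simp add: not_le)

text \<open>
  Time runs downwards. A member of \<open>partial Op Cl t\<close> sends each closer at a time \<open>\<ge> t\<close> to its
  opener and uses every opener at a time \<open>\<ge> t\<close>. The open word lists the openers of the arcs that
  are open at time \<open>t\<close>, by decreasing closer, so that its increasing subsequences are nestings
  and its decreasing ones are crossings.
\<close>

definition partial :: "nat set \<Rightarrow> nat set \<Rightarrow> nat \<Rightarrow> (nat \<Rightarrow> nat) set" where
  "partial Op Cl t = {f \<in> (Cl \<inter> {t..}) \<rightarrow>\<^sub>E Op. inj_on f (Cl \<inter> {t..}) \<and> (\<forall>j\<in>Cl \<inter> {t..}. f j < j) \<and>
     Op \<inter> {t..} \<subseteq> f ` (Cl \<inter> {t..})}"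

definition open_word :: "nat set \<Rightarrow> nat \<Rightarrow> (nat \<Rightarrow> nat) \<Rightarrow> nat list" where
  "open_word Cl t f = filter (\<lambda>i. i < t) (map f (rev (sorted_list_of_set (Cl \<inter> {t..}))))"

text \<open>Prescribing the tableau at time \<open>t\<close> makes these sets split along a single
  step of the walk. All times \<open>s \<ge> t\<close> are bounded, since a crossing or nesting is
  visible only while all its arcs are open.\<close>

definition good :: "nat set \<Rightarrow> nat set \<Rightarrow> nat \<Rightarrow> nat \<Rightarrow> nat \<Rightarrow> nat set list \<Rightarrow> (nat \<Rightarrow> nat) set" where
  "good Op Cl j k t T = {f \<in> partial Op Cl t. ptab (open_word Cl t f) = T \<and>
     (\<forall>s\<ge>t. shape_ok j k (dia (ptab (open_word Cl s f))))}"

section \<open>Gluing bijections fibre by fibre\<close>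

lemma bij_betw_conjugate:
  assumes "\<exists>h. bij_betw h X Y" "bij_betw a X A" "bij_betw b Y B"
  shows "\<exists>h. bij_betw h A B"
proof -
  obtain h where "bij_betw h X Y" using assms(1) by blast
  then show ?thesis
    using bij_betw_trans[OF bij_betw_trans[OF bij_betw_inv_into[OF assms(2)]] assms(3)] by blast
qed

text \<open>\<open>d\<close> and \<open>d'\<close> label the two index sets, later by shapes, and
  \<open>e\<close> matches the labels, later by transposition. This pairs the indices, and one
  chosen bijection for each pair of fibres gives the whole.\<close>

lemma Sigma_bij_betw:
  assumes d: "bij_betw d X Y" and d': "bij_betw d' X' Y'" and e: "bij_betw e Y Y'"
    and h: "\<And>p p'. p \<in> X \<Longrightarrow> p' \<in> X' \<Longrightarrow> d' p' = e (d p) \<Longrightarrow> \<exists>h. bij_betw h (A p) (B p')"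
  shows "\<exists>h. bij_betw h (Sigma X A) (Sigma X' B)"
proof -
  define q where "q = inv_into X' d' \<circ> (e \<circ> d)"
  have q: "bij_betw q X X'"
    unfolding q_def using bij_betw_trans[OF bij_betw_trans[OF d e] bij_betw_inv_into[OF d']] .
  have "d' (q p) = e (d p)" if "p \<in> X" for p
    unfolding q_def using that bij_betwE[OF bij_betw_trans[OF d e]] bij_betw_inv_into_right[OF d'] by auto
  then have "\<forall>p\<in>X. \<exists>h. bij_betw h (A p) (B (q p))"
    using h bij_betwE[OF q] by blast
  then obtain g where g: "\<And>p. p \<in> X \<Longrightarrow> bij_betw (g p) (A p) (B (q p))" by metis
  have "bij_betw (\<lambda>(p, a). (q p, g p a)) (Sigma X A) (Sigma X' B)"
    unfolding bij_betw_def
  proof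
    show "inj_on (\<lambda>(p, a). (q p, g p a)) (Sigma X A)"
    proof (rule inj_onI, clarify)
      fix p a p' a'
      assume *: "p \<in> X" "a \<in> A p" "p' \<in> X" "a' \<in> A p'" "q p = q p'" "g p a = g p' a'"
      have "p = p'" using q * by (meson bij_betw_imp_inj_on inj_onD)
      then show "p = p' \<and> a = a'" using g[of p] * by (metis bij_betw_imp_inj_on inj_onD)
    qed
    show "(\<lambda>(p, a). (q p, g p a)) ` Sigma X A = Sigma X' B"
    proof
      show "(\<lambda>(p, a). (q p, g p a)) ` Sigma X A \<subseteq> Sigma X' B"
        using bij_betwE[OF q] bij_betwE[OF g] by auto
      show "Sigma X' B \<subseteq> (\<lambda>(p, a). (q p, g p a)) ` Sigma X A"
      proof clarify
        fix p' b assume *: "p' \<in> X'" "b \<in> B p'"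
        then obtain p where p: "p \<in> X" "q p = p'" using q by (auto simp: bij_betw_def)
        then obtain a where "a \<in> A p" "g p a = b"
          using g[OF p(1)] *(2) unfolding bij_betw_def by (metis imageE)
        then show "(p', b) \<in> (\<lambda>(p, a). (q p, g p a)) ` Sigma X A" using p by force
      qed
    qed
  qed
  then show ?thesis by blast
qed

lemma good_iff:
  "f \<in> good Op Cl j k t T \<longleftrightarrow> shape_ok j k (dia T) \<and> f \<in> partial Op Cl t \<and> ptab (open_word Cl t f) = T \<and>
     (\<forall>s\<ge>Suc t. shape_ok j k (dia (ptab (open_word Cl s f))))"
proof -
  have "(\<forall>s\<ge>t. Q s) \<longleftrightarrow> Q t \<and> (\<forall>s\<ge>Suc t. Q s)" for Q
    by (metis Suc_le_eq order_le_less)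
  then show ?thesis unfolding good_def by auto
qed

lemma swap_image_insert_iff:
  fixes D E :: "(nat \<times> nat) set"
  shows "(\<exists>c. c \<notin> D \<and> E = insert c D) \<longleftrightarrow>
    (\<exists>c. c \<notin> prod.swap ` D \<and> prod.swap ` E = insert c (prod.swap ` D))"
proof -
  have *: "\<exists>c. c \<notin> prod.swap ` D \<and> prod.swap ` E = insert c (prod.swap ` D)"
    if h: "\<exists>c. c \<notin> D \<and> E = insert c D" for D E :: "(nat \<times> nat) set"
  proof -
    obtain c where "c \<notin> D" "E = insert c D" using h by blast
    then show ?thesis by (intro exI[of _ "prod.swap c"]) (cases c, auto)
  qed
  have s: "prod.swap ` prod.swap ` F = F" for F :: "(nat \<times> nat) set" by (simp add: image_image)
  show ?thesis using *[of D E] *[of "prod.swap ` D" "prod.swap ` E"] unfolding s by blast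
qed

lemma young_swap: "young (prod.swap ` D) \<longleftrightarrow> young D"
proof -
  have "(a, b) \<in> prod.swap ` D \<longleftrightarrow> (b, a) \<in> D" for a b by force
  then show ?thesis unfolding young_def by metis
qed

lemma bij_betw_swap_Collect:
  fixes Q Q' :: "(nat \<times> nat) set \<Rightarrow> bool"
  assumes "\<And>D. Q' (prod.swap ` D) \<longleftrightarrow> Q D"
  shows "bij_betw ((`) prod.swap) (Collect Q) (Collect Q')"
proof (rule bij_betw_byWitness[where f' = "(`) prod.swap"])
  have s: "prod.swap ` prod.swap ` F = F" for F :: "(nat \<times> nat) set" by (simp add: image_image)
  show "\<forall>a\<in>Collect Q. prod.swap ` prod.swap ` a = a" "\<forall>a\<in>Collect Q'. prod.swap ` prod.swap ` a = a"
    using s by auto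
  show "(`) prod.swap ` Collect Q \<subseteq> Collect Q'" using assms by auto
  show "(`) prod.swap ` Collect Q' \<subseteq> Collect Q" using assms s by (metis (no_types, lifting) image_subsetI mem_Collect_eq)
qed

section \<open>One step of the walk: closer, opener, or neither\<close>

context
  fixes Op Cl :: "nat set"
  assumes fin: "finite Op" "finite Cl" and disj: "Op \<inter> Cl = {}"
begin

lemma set_open_word: "set (open_word Cl t f) = f ` (Cl \<inter> {t..}) \<inter> {..<t}"
  using fin by (auto simp: open_word_def)

lemma distinct_open_word:
  assumes "f \<in> partial Op Cl t"
  shows "distinct (open_word Cl t f)"
  using assms fin by (simp add: open_word_def partial_def distinct_map)

lemma open_word_cong:
  assumes "\<And>j. j \<in> Cl \<Longrightarrow> t \<le> j \<Longrightarrow> f j = g j"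
  shows "open_word Cl t f = open_word Cl t g"
proof -
  have "map f (rev (sorted_list_of_set (Cl \<inter> {t..}))) = map g (rev (sorted_list_of_set (Cl \<inter> {t..})))"
    using fin assms by simp
  then show ?thesis by (simp only: open_word_def)
qed

text \<open>Among the closers at times \<open>\<ge> t\<close>, \<open>t\<close> is the smallest, and
  the word runs by decreasing closer, so \<open>f t\<close> comes last. The last assumption ensures
  that lowering the threshold from \<open>Suc t\<close> to \<open>t\<close> removes no other
  letter.\<close>

lemma open_word_closer:
  assumes "t \<in> Cl" "f t < t" "t \<notin> f ` (Cl \<inter> {Suc t..})"
  shows "open_word Cl t f = open_word Cl (Suc t) f @ [f t]"
proof -
  have "sorted_list_of_set (Cl \<inter> {t..}) = t # sorted_list_of_set (Cl \<inter> {Suc t..})"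
    using fin assms(1) by (intro sorted_list_of_set_eqI) (auto simp: Suc_le_eq order_le_less)
  moreover have "filter (\<lambda>i. i < t) (map f (rev (sorted_list_of_set (Cl \<inter> {Suc t..})))) = open_word Cl (Suc t) f"
    unfolding open_word_def using fin assms(3) by (intro filter_cong) (auto simp: less_Suc_eq)
  ultimately show ?thesis using assms(2) by (simp add: open_word_def)
qed

lemma not_closer: "t \<notin> Cl \<Longrightarrow> Cl \<inter> {t..} = Cl \<inter> {Suc t..}"
  by (auto simp: Suc_le_eq order_le_less)

lemma open_word_not_closer:
  assumes "t \<notin> Cl"
  shows "open_word Cl t f = filter (\<lambda>i. i < t) (open_word Cl (Suc t) f)"
  unfolding open_word_def not_closer[OF assms] filter_filter by (rule filter_cong) auto

lemma partial_insert:
  assumes "t \<in> Cl" "g \<in> partial Op Cl (Suc t)" "x \<in> Op" "x < t" "x \<notin> g ` (Cl \<inter> {Suc t..})"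
  shows "g(t := x) \<in> partial Op Cl t"
proof -
  have C: "Cl \<inter> {t..} = insert t (Cl \<inter> {Suc t..})" using assms(1) by (auto simp: Suc_le_eq order_le_less)
  have im: "g(t := x) ` (Cl \<inter> {t..}) = insert x (g ` (Cl \<inter> {Suc t..}))"
    unfolding C by auto
  have O: "Op \<inter> {t..} = Op \<inter> {Suc t..}" using assms(1) disj by (auto simp: Suc_le_eq order_le_less)
  have g: "g \<in> (Cl \<inter> {Suc t..}) \<rightarrow>\<^sub>E Op" "inj_on g (Cl \<inter> {Suc t..})" "\<forall>j\<in>Cl \<inter> {Suc t..}. g j < j"
    "Op \<inter> {Suc t..} \<subseteq> g ` (Cl \<inter> {Suc t..})" using assms(2) by (auto simp: partial_def)
  have "g(t := x) \<in> insert t (Cl \<inter> {Suc t..}) \<rightarrow>\<^sub>E Op" using g(1) assms(3) by (intro PiE_fun_upd) auto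
  moreover have "inj_on (g(t := x)) (insert t (Cl \<inter> {Suc t..}))"
    using g(2) assms(5) by (auto simp: inj_on_def)
  moreover have "\<forall>j\<in>insert t (Cl \<inter> {Suc t..}). (g(t := x)) j < j" using g(3) assms(4) by auto
  moreover have "Op \<inter> {t..} \<subseteq> g(t := x) ` (Cl \<inter> {t..})" unfolding im O using g(4) by blast
  ultimately show ?thesis unfolding partial_def C by blast
qed

lemma partial_restrict:
  assumes "t \<in> Cl" "f \<in> partial Op Cl t"
  shows "restrict f (Cl \<inter> {Suc t..}) \<in> partial Op Cl (Suc t)"
    and "f t \<in> Op" "f t < t" "f t \<notin> f ` (Cl \<inter> {Suc t..})"
proof -
  have C: "Cl \<inter> {t..} = insert t (Cl \<inter> {Suc t..})" using assms(1) by (auto simp: Suc_le_eq order_le_less)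
  have f: "f \<in> insert t (Cl \<inter> {Suc t..}) \<rightarrow>\<^sub>E Op" "inj_on f (insert t (Cl \<inter> {Suc t..}))"
    "\<forall>j\<in>insert t (Cl \<inter> {Suc t..}). f j < j"
    "Op \<inter> {t..} \<subseteq> f ` (insert t (Cl \<inter> {Suc t..}))" using assms(2) unfolding partial_def C by auto
  show 1: "f t \<in> Op" "f t < t" "f t \<notin> f ` (Cl \<inter> {Suc t..})"
    using f(1,2,3) by (auto simp: inj_on_def)
  have im: "restrict f (Cl \<inter> {Suc t..}) ` (Cl \<inter> {Suc t..}) = f ` (Cl \<inter> {Suc t..})" by auto
  have "restrict f (Cl \<inter> {Suc t..}) \<in> (Cl \<inter> {Suc t..}) \<rightarrow>\<^sub>E Op" using f(1) by auto
  moreover have "inj_on (restrict f (Cl \<inter> {Suc t..})) (Cl \<inter> {Suc t..})"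
    using f(2) by (simp add: inj_on_def)
  moreover have "\<forall>j\<in>Cl \<inter> {Suc t..}. restrict f (Cl \<inter> {Suc t..}) j < j" using f(3) by simp
  moreover have "Op \<inter> {Suc t..} \<subseteq> f ` (Cl \<inter> {Suc t..})"
    using f(4) 1(2) by auto
  ultimately show "restrict f (Cl \<inter> {Suc t..}) \<in> partial Op Cl (Suc t)"
    unfolding partial_def mem_Collect_eq im by (intro conjI)
qed

text \<open>Splitting off the value at the closer \<open>t\<close> inverts the map: the restriction
  of \<open>f\<close> has tableau \<open>S\<close> at time \<open>Suc t\<close>, and
  \<open>f t\<close> is the letter inserted last.\<close>

lemma good_closer:
  assumes "t \<in> Cl" "tab T" "\<Union>(set T) \<subseteq> Op \<inter> {..<t}" "shape_ok j k (dia T)"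
  shows "bij_betw (\<lambda>((S, x), g). g(t := x))
    (SIGMA p:{(S, x). tab S \<and> x \<notin> \<Union>(set S) \<and> ins x S = T}. good Op Cl j k (Suc t) (fst p))
    (good Op Cl j k t T)" (is "bij_betw ?F (Sigma ?X ?A) ?G")
  unfolding bij_betw_def
proof
  \<comment> \<open>\<open>g\<close> is extensional and \<open>t\<close> is outside its domain, so
    overwriting \<open>g t\<close> loses no information.\<close>
  have ext: "g t = undefined" if "g \<in> good Op Cl j k (Suc t) S" for g S
    using that by (auto simp: good_def partial_def PiE_def extensional_def)
  have up: "open_word Cl s (g(t := x)) = open_word Cl s g" if "Suc t \<le> s" for g x s
    using that by (intro open_word_cong) auto
  show "inj_on ?F (Sigma ?X ?A)"
  proof (rule inj_onI)
    fix p p' assume "p \<in> Sigma ?X ?A" "p' \<in> Sigma ?X ?A" "?F p = ?F p'"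
    then obtain S x g S' x' g' where p: "p = ((S, x), g)" "p' = ((S', x'), g')"
      and *: "g \<in> good Op Cl j k (Suc t) S" "g' \<in> good Op Cl j k (Suc t) S'"
      "g(t := x) = g'(t := x')" by auto
    have "x = x'" using *(3) by (metis fun_upd_same)
    have "g = g'" using *(3) ext[OF *(1)] ext[OF *(2)] by (metis fun_upd_triv fun_upd_upd)
    moreover have "S = S'" using * \<open>g = g'\<close> by (auto simp: good_def)
    ultimately show "p = p'" using \<open>x = x'\<close> p by simp
  qed
  show "?F ` Sigma ?X ?A = ?G"
  proof
    show "?F ` Sigma ?X ?A \<subseteq> ?G"
    proof clarify
      fix S x g
      assume *: "tab S" "x \<notin> \<Union>(set S)" "T = ins x S" "g \<in> good Op Cl j k (Suc t) (fst (S, x))"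
      have g: "g \<in> partial Op Cl (Suc t)" "ptab (open_word Cl (Suc t) g) = S"
        "\<forall>s\<ge>Suc t. shape_ok j k (dia (ptab (open_word Cl s g)))" using *(4) by (auto simp: good_def)
      have "\<Union>(set T) = insert x (\<Union>(set S))" using *(1-3) entries_ins by blast
      then have x: "x \<in> Op" "x < t" using assms(3) by auto
      \<comment> \<open>The values of \<open>g\<close> below \<open>Suc t\<close> are exactly the
        entries of \<open>S\<close>, so for \<open>x < t\<close> freshness in the tableau is
        freshness among the values, which keeps the extended function injective.\<close>
      have ent: "\<Union>(set S) = g ` (Cl \<inter> {Suc t..}) \<inter> {..<Suc t}"
        using entries_ptab[OF distinct_open_word[OF g(1)]] g(2) set_open_word by simp
      then have nx: "x \<notin> g ` (Cl \<inter> {Suc t..})" using *(2) x by auto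
      have "g ` (Cl \<inter> {Suc t..}) \<subseteq> Op" using g(1) by (auto simp: partial_def)
      then have nt: "t \<notin> (g(t := x)) ` (Cl \<inter> {Suc t..})" using disj assms(1) by auto
      have "open_word Cl t (g(t := x)) = open_word Cl (Suc t) g @ [x]"
        using open_word_closer[OF assms(1) _ nt] x up by simp
      then have "ptab (open_word Cl t (g(t := x))) = T" using g(2) *(3) by simp
      then show "g(t := x) \<in> good Op Cl j k t (ins x S)"
        using partial_insert[OF assms(1) g(1) x nx] assms(4) g(3) up *(3) unfolding good_iff by simp
    qed
    show "?G \<subseteq> ?F ` Sigma ?X ?A"
    proof
      fix f assume "f \<in> ?G"
      then have f: "f \<in> partial Op Cl t" "ptab (open_word Cl t f) = T"
        "\<forall>s\<ge>Suc t. shape_ok j k (dia (ptab (open_word Cl s f)))" by (auto simp: good_iff)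
      define g where "g = restrict f (Cl \<inter> {Suc t..})"
      note r = partial_restrict[OF assms(1) f(1), folded g_def]
      have gw: "open_word Cl s g = open_word Cl s f" if "Suc t \<le> s" for s
        using that by (intro open_word_cong) (auto simp: g_def)
      have "f ` (Cl \<inter> {Suc t..}) \<subseteq> Op" using f(1) by (auto simp: partial_def)
      then have nt: "t \<notin> f ` (Cl \<inter> {Suc t..})" using disj assms(1) by auto
      define S where "S = ptab (open_word Cl (Suc t) g)"
      have d: "distinct (open_word Cl (Suc t) g)" using distinct_open_word[OF r(1)] .
      have T: "ins (f t) S = T"
        using open_word_closer[OF assms(1) r(3) nt] f(2) gw by (simp add: S_def)
      have "\<Union>(set S) = f ` (Cl \<inter> {Suc t..}) \<inter> {..<Suc t}"
        using entries_ptab[OF d] gw[OF order_refl] by (simp only: S_def set_open_word)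
      then have "f t \<notin> \<Union>(set S)" using r(4) by (simp only: Int_iff simp_thms)
      moreover have "tab S" unfolding S_def using tab_ptab[OF d] .
      moreover have "g \<in> good Op Cl j k (Suc t) S" using r(1) f(3) gw by (simp add: good_def S_def)
      moreover have "f = g(t := f t)"
      proof
        fix i
        show "f i = (g(t := f t)) i"
          using f(1) by (auto simp: g_def partial_def PiE_def extensional_def Suc_le_eq order_le_less)
      qed
      ultimately show "f \<in> ?F ` Sigma ?X ?A" using T by (intro image_eqI[of _ _ "((S, f t), g)"]) auto
    qed
  qed
qed

text \<open>At an opener no value is chosen, so \<open>f\<close> stays the same and only the
  recorded tableau changes. The demand that the opener \<open>t\<close> be used appears as
  \<open>t\<close> being an entry of \<open>S\<close>.\<close>

lemma good_opener:
  assumes "t \<in> Op" "tab T" "\<Union>(set T) \<subseteq> Op \<inter> {..<t}" "shape_ok j k (dia T)"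
  shows "bij_betw snd
    (SIGMA S:{S. tab S \<and> \<Union>(set S) = insert t (\<Union>(set T)) \<and> res t S = T}. good Op Cl j k (Suc t) S)
    (good Op Cl j k t T)" (is "bij_betw snd (Sigma ?X ?A) ?G")
  unfolding bij_betw_def
proof
  have nc: "t \<notin> Cl" using assms(1) disj by auto
  have C: "Cl \<inter> {t..} = Cl \<inter> {Suc t..}" using not_closer[OF nc] .
  have O: "Op \<inter> {t..} = insert t (Op \<inter> {Suc t..})" using assms(1) by (auto simp: Suc_le_eq order_le_less)
  have P: "f \<in> partial Op Cl t \<longleftrightarrow> f \<in> partial Op Cl (Suc t) \<and> t \<in> f ` (Cl \<inter> {Suc t..})" for f
    unfolding partial_def C O by auto
  have E: "\<Union>(set (ptab (open_word Cl (Suc t) f))) = f ` (Cl \<inter> {Suc t..}) \<inter> {..<Suc t}"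
    if "f \<in> partial Op Cl (Suc t)" for f
    using entries_ptab[OF distinct_open_word[OF that]] set_open_word by simp
  have R: "ptab (open_word Cl t f) = res t (ptab (open_word Cl (Suc t) f))"
    if "f \<in> partial Op Cl (Suc t)" for f
    using ptab_filter[OF distinct_open_word[OF that]] open_word_not_closer[OF nc] by simp
  show "inj_on snd (Sigma ?X ?A)"
    by (auto simp: inj_on_def good_def)
  show "snd ` Sigma ?X ?A = ?G"
  proof
    show "snd ` Sigma ?X ?A \<subseteq> ?G"
    proof clarify
      fix S f
      assume *: "tab S" "\<Union>(set S) = insert t (\<Union>(set (res t S)))" "T = res t S" "f \<in> good Op Cl j k (Suc t) S"
      have f: "f \<in> partial Op Cl (Suc t)" "ptab (open_word Cl (Suc t) f) = S"
        "\<forall>s\<ge>Suc t. shape_ok j k (dia (ptab (open_word Cl s f)))" using *(4) by (auto simp: good_def)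
      have "t \<in> \<Union>(set S)" using *(2) by simp
      then have "t \<in> f ` (Cl \<inter> {Suc t..})" using E[OF f(1)] f(2) by blast
      then have "f \<in> partial Op Cl t" using P f(1) by simp
      then show "snd (S, f) \<in> good Op Cl j k t (res t S)"
        using R[OF f(1)] f *(3) assms(4) by (simp add: good_iff)
    qed
    show "?G \<subseteq> snd ` Sigma ?X ?A"
    proof
      fix f assume "f \<in> ?G"
      then have f: "f \<in> partial Op Cl t" "ptab (open_word Cl t f) = T"
        "\<forall>s\<ge>Suc t. shape_ok j k (dia (ptab (open_word Cl s f)))" by (auto simp: good_iff)
      have f': "f \<in> partial Op Cl (Suc t)" "t \<in> f ` (Cl \<inter> {Suc t..})" using f(1) P by auto
      define S where "S = ptab (open_word Cl (Suc t) f)"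
      have tS: "tab S" using tab_ptab[OF distinct_open_word[OF f'(1)]] by (simp add: S_def)
      have rS: "res t S = T" using R[OF f'(1)] f(2) by (simp add: S_def)
      have "\<Union>(set S) = f ` (Cl \<inter> {Suc t..}) \<inter> {..<Suc t}" using E[OF f'(1)] by (simp add: S_def)
      moreover have "\<Union>(set T) = \<Union>(set S) \<inter> {..<t}" using entries_res[OF tS] rS by metis
      ultimately have "\<Union>(set S) = insert t (\<Union>(set T))" using f'(2) by (auto simp: less_Suc_eq)
      moreover have "f \<in> good Op Cl j k (Suc t) S" using f f' by (simp add: good_def S_def)
      ultimately show "f \<in> snd ` Sigma ?X ?A" using tS rS by (intro image_eqI[of _ _ "(S, f)"]) auto
    qed
  qed
qed

lemma good_neither:
  assumes "t \<notin> Op" "t \<notin> Cl" "shape_ok j k (dia T)"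
  shows "good Op Cl j k t T = good Op Cl j k (Suc t) T"
proof -
  have C: "Cl \<inter> {t..} = Cl \<inter> {Suc t..}" using not_closer[OF assms(2)] .
  have O: "Op \<inter> {t..} = Op \<inter> {Suc t..}" using assms(1) by (auto simp: Suc_le_eq order_le_less)
  have P: "partial Op Cl t = partial Op Cl (Suc t)" unfolding partial_def C O ..
  have W: "open_word Cl t f = open_word Cl (Suc t) f" if "f \<in> partial Op Cl (Suc t)" for f
  proof -
    have "f ` (Cl \<inter> {Suc t..}) \<subseteq> Op" using that by (auto simp: partial_def)
    then have "t \<notin> set (open_word Cl (Suc t) f)" using assms(1) by (auto simp: set_open_word)
    moreover have "\<forall>i\<in>set (open_word Cl (Suc t) f). i < Suc t" by (simp add: set_open_word)
    ultimately show ?thesis unfolding open_word_not_closer[OF assms(2)]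
      by (metis filter_True less_SucE)
  qed
  show ?thesis
  proof (rule set_eqI)
    fix f
    show "f \<in> good Op Cl j k t T \<longleftrightarrow> f \<in> good Op Cl j k (Suc t) T"
      using assms(3) P W[of f] by (auto simp: good_iff[of f Op Cl j k t T] good_def[of _ _ _ _ "Suc t"])
  qed
qed

text \<open>Induction downwards from a time \<open>N\<close> beyond all points. The entries of
  \<open>T\<close> and \<open>T'\<close> may differ: the tableaux at \<open>Suc t\<close> are
  matched by shape alone, and the letters inserted on the two sides need not be the same. With this
  freedom the induction hypothesis applies to every matched pair.\<close>

lemma good_swap:
  assumes "Op \<union> Cl \<subseteq> {..<N}" "t \<le> N"
    and "tab T" "tab T'" "\<Union>(set T) \<subseteq> Op \<inter> {..<t}" "\<Union>(set T') \<subseteq> Op \<inter> {..<t}" "dia T' = prod.swap ` dia T"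
  shows "\<exists>h. bij_betw h (good Op Cl j k t T) (good Op Cl k j t T')"
  using assms(2-)
proof (induction arbitrary: T T' rule: inc_induct)
  case base
  have C: "Cl \<inter> {s..} = {}" if "N \<le> s" for s using assms(1) that by auto
  have W: "open_word Cl s f = []" if "N \<le> s" for s f using C[OF that] by (simp add: open_word_def)
  have "T = [] \<longleftrightarrow> T' = []"
    using dia_eq_empty[of T] dia_eq_empty[of T'] base by simp
  \<comment> \<open>The open word is empty, so a nonempty tableau admits no \<open>f\<close> on
    either side, and for the empty one both bounds read \<open>0 < j\<close> and
    \<open>0 < k\<close>.\<close>
  then have "good Op Cl j k N T = good Op Cl k j N T'"
    using W by (auto simp: good_def shape_ok_def)
  then show ?case using bij_betw_id by metis
next
  case (step t)
  have ok: "shape_ok k j (dia T') = shape_ok j k (dia T)" using step.prems(5) shape_ok_swap by metis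
  show ?case
  proof (cases "shape_ok j k (dia T)")
    case False
    then have "good Op Cl j k t T = {}" "good Op Cl k j t T' = {}"
      using ok by (auto simp: good_iff)
    then show ?thesis using bij_betw_id by metis
  next
    case True
    then have True': "shape_ok k j (dia T')" using ok by simp
    consider "t \<in> Cl" | "t \<in> Op" | "t \<notin> Op" "t \<notin> Cl" by blast
    then show ?thesis
    proof cases
      case 1
      have "\<exists>h. bij_betw h
        (SIGMA p:{(S, x). tab S \<and> x \<notin> \<Union>(set S) \<and> ins x S = T}. good Op Cl j k (Suc t) (fst p))
        (SIGMA p:{(S, x). tab S \<and> x \<notin> \<Union>(set S) \<and> ins x S = T'}. good Op Cl k j (Suc t) (fst p))"
      proof (rule Sigma_bij_betw[OF bij_betw_ins[OF step.prems(1)] bij_betw_ins[OF step.prems(2)]])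
        show "bij_betw ((`) prod.swap) {D. young D \<and> (\<exists>c. c \<notin> D \<and> dia T = insert c D)}
          {D. young D \<and> (\<exists>c. c \<notin> D \<and> dia T' = insert c D)}"
          unfolding step.prems(5) by (intro bij_betw_swap_Collect) (simp only: young_swap swap_image_insert_iff[symmetric])
        fix p p'
        assume "p \<in> {(S, x). tab S \<and> x \<notin> \<Union>(set S) \<and> ins x S = T}"
          and "p' \<in> {(S, x). tab S \<and> x \<notin> \<Union>(set S) \<and> ins x S = T'}"
          and eq: "(dia \<circ> fst) p' = prod.swap ` (dia \<circ> fst) p"
        then obtain S x S' x' where p: "p = (S, x)" "tab S" "x \<notin> \<Union>(set S)" "ins x S = T"
          and p': "p' = (S', x')" "tab S'" "x' \<notin> \<Union>(set S')" "ins x' S' = T'" by auto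
        have "\<Union>(set S) \<subseteq> Op \<inter> {..<Suc t}" "\<Union>(set S') \<subseteq> Op \<inter> {..<Suc t}"
          using entries_ins[OF p(2,3)] entries_ins[OF p'(2,3)] step.prems(3,4) p(4) p'(4) by auto
        then show "\<exists>h. bij_betw h (good Op Cl j k (Suc t) (fst p)) (good Op Cl k j (Suc t) (fst p'))"
          using step.IH[of S S'] p p' eq by simp
      qed
      then show ?thesis
        using good_closer[OF 1 step.prems(1,3) True] good_closer[OF 1 step.prems(2,4) True']
        by (rule bij_betw_conjugate)
    next
      case 2
      have sub: "\<Union>(set T) \<subseteq> {..<t}" "\<Union>(set T') \<subseteq> {..<t}" using step.prems(3,4) by auto
      have "\<exists>h. bij_betw h
        (SIGMA S:{S. tab S \<and> \<Union>(set S) = insert t (\<Union>(set T)) \<and> res t S = T}. good Op Cl j k (Suc t) S)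
        (SIGMA S:{S. tab S \<and> \<Union>(set S) = insert t (\<Union>(set T')) \<and> res t S = T'}. good Op Cl k j (Suc t) S)"
      proof (rule Sigma_bij_betw[OF bij_betw_res[OF step.prems(1) sub(1)] bij_betw_res[OF step.prems(2) sub(2)]])
        show "bij_betw ((`) prod.swap) {D. young D \<and> (\<exists>c. c \<notin> dia T \<and> D = insert c (dia T))}
          {D. young D \<and> (\<exists>c. c \<notin> dia T' \<and> D = insert c (dia T'))}"
          unfolding step.prems(5) by (intro bij_betw_swap_Collect) (simp only: young_swap swap_image_insert_iff[symmetric])
        fix S S'
        assume S: "S \<in> {S. tab S \<and> \<Union>(set S) = insert t (\<Union>(set T)) \<and> res t S = T}"
          and S': "S' \<in> {S. tab S \<and> \<Union>(set S) = insert t (\<Union>(set T')) \<and> res t S = T'}"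
          and eq: "dia S' = prod.swap ` dia S"
        have "\<Union>(set S) \<subseteq> Op \<inter> {..<Suc t}" "\<Union>(set S') \<subseteq> Op \<inter> {..<Suc t}"
          using S S' step.prems(3,4) 2 by auto
        then show "\<exists>h. bij_betw h (good Op Cl j k (Suc t) S) (good Op Cl k j (Suc t) S')"
          using step.IH[of S S'] S S' eq by simp
      qed
      then show ?thesis
        using good_opener[OF 2 step.prems(1,3) True] good_opener[OF 2 step.prems(2,4) True']
        by (rule bij_betw_conjugate)
    next
      case 3
      have "\<Union>(set T) \<subseteq> Op \<inter> {..<Suc t}" "\<Union>(set T') \<subseteq> Op \<inter> {..<Suc t}"
        using step.prems(3,4) by auto
      then show ?thesis
        unfolding good_neither[OF 3 True] good_neither[OF 3 True']
        using step.IH[of T T'] step.prems by blast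
    qed
  qed
qed

text \<open>At time 0 nothing is open, so every walk ends in the empty tableau, whose shape is its
  own transpose.\<close>

lemma chain_free_swap:
  "\<exists>h. bij_betw h
    {f \<in> partial Op Cl 0. \<forall>s. \<not> chain (<) j (open_word Cl s f) \<and> \<not> chain (>) k (open_word Cl s f)}
    {f \<in> partial Op Cl 0. \<forall>s. \<not> chain (<) k (open_word Cl s f) \<and> \<not> chain (>) j (open_word Cl s f)}"
proof -
  obtain N where N: "Op \<union> Cl \<subseteq> {..<N}"
    using fin finite_nat_set_iff_bounded[of "Op \<union> Cl"] by auto
  have "distinct (open_word Cl s f)" if "f \<in> partial Op Cl 0" for s f
  proof -
    have "inj_on f Cl" using that by (simp add: partial_def)
    then show ?thesis using fin unfolding open_word_def by (simp add: distinct_map inj_on_subset)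
  qed
  moreover have "open_word Cl 0 f = []" for f by (simp add: open_word_def)
  ultimately have *: "good Op Cl j k 0 [] = {f \<in> partial Op Cl 0.
      \<forall>s. \<not> chain (<) j (open_word Cl s f) \<and> \<not> chain (>) k (open_word Cl s f)}" for j k
    by (auto simp: good_def shape_ok_ptab)
  show ?thesis using good_swap[OF N, of 0 "[]" "[]" j k] unfolding * by simp
qed

end

section \<open>Crossings and nestings of arc sets\<close>

definition matching :: "arc set \<Rightarrow> bool" where
  "matching M \<longleftrightarrow> finite M \<and> inj_on fst M \<and> inj_on snd M \<and> (\<forall>a\<in>M. fst a < snd a)"

definition crosses :: "nat \<Rightarrow> arc set \<Rightarrow> bool" where
  "crosses k M \<longleftrightarrow> (\<exists>as. length as = k \<and> set as \<subseteq> M \<and> sorted_wrt (<) (map fst as @ map snd as))"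

definition nests :: "nat \<Rightarrow> arc set \<Rightarrow> bool" where
  "nests k M \<longleftrightarrow> (\<exists>as. length as = k \<and> set as \<subseteq> M \<and> sorted_wrt (<) (map fst as @ rev (map snd as)))"

text \<open>Listed by decreasing closers, nestings have increasing and crossings decreasing openers.
  This is the order of the open word, and \<open>R\<close> allows both to be treated at
  once.\<close>

definition arc_pattern :: "(nat \<Rightarrow> nat \<Rightarrow> bool) \<Rightarrow> nat \<Rightarrow> arc set \<Rightarrow> bool" where
  "arc_pattern R k M \<longleftrightarrow> (\<exists>as. length as = k \<and> set as \<subseteq> M \<and> sorted_wrt R (map fst as) \<and>
     sorted_wrt (>) (map snd as) \<and> (\<forall>a\<in>set as. \<forall>b\<in>set as. fst a < snd b))"

lemma nests_iff_arc_pattern: "nests k M \<longleftrightarrow> arc_pattern (<) k M"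
  unfolding nests_def arc_pattern_def
  by (intro arg_cong[where f = Ex] ext) (auto simp: sorted_wrt_append sorted_wrt_rev)

lemma crosses_iff_arc_pattern: "crosses k M \<longleftrightarrow> arc_pattern (>) k M"
proof
  assume "crosses k M"
  then obtain as where as: "length as = k" "set as \<subseteq> M" "sorted_wrt (<) (map fst as @ map snd as)"
    by (auto simp: crosses_def)
  then show "arc_pattern (>) k M"
    unfolding arc_pattern_def by (intro exI[of _ "rev as"])
      (auto simp: sorted_wrt_append sorted_wrt_rev rev_map[symmetric])
next
  assume "arc_pattern (>) k M"
  then obtain as where as: "length as = k" "set as \<subseteq> M" "sorted_wrt (>) (map fst as)"
      "sorted_wrt (>) (map snd as)" "\<forall>a\<in>set as. \<forall>b\<in>set as. fst a < snd b"
    by (auto simp: arc_pattern_def)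
  then show "crosses k M"
    unfolding crosses_def by (intro exI[of _ "rev as"])
      (auto simp: sorted_wrt_append sorted_wrt_rev rev_map[symmetric])
qed

lemma subseq_mapE:
  assumes "subseq v (map f L)"
  obtains js where "subseq js L" "v = map f js"
  using assms subseq_conv_nths nths_map by metis

lemma subseq_if_decreasing:
  fixes js L :: "nat list"
  assumes "sorted_wrt (>) js" "sorted_wrt (>) L" "set js \<subseteq> set L"
  shows "subseq js L"
proof -
  have "sorted_wrt (<) (rev (filter (\<lambda>x. x \<in> set js) L))"
    using assms(2) by (simp add: sorted_wrt_rev sorted_wrt_filter)
  moreover have "set (rev (filter (\<lambda>x. x \<in> set js) L)) = set js" using assms(3) by auto
  ultimately have "sorted_list_of_set (set js) = rev (filter (\<lambda>x. x \<in> set js) L)"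
    by (rule sorted_list_of_set_eqI)
  moreover have "sorted_list_of_set (set js) = rev js"
    using assms(1) by (intro sorted_list_of_set_eqI) (simp_all add: sorted_wrt_rev)
  ultimately have "js = filter (\<lambda>x. x \<in> set js) L" by simp
  then show ?thesis by (metis subseq_filter_left)
qed

text \<open>Passing from the letters to the closers that carry them turns a subsequence of the word
  into a list of arcs; the last condition says that all of them are open at time
  \<open>s\<close>.\<close>

lemma chain_open_word_iff:
  assumes "finite Cl"
  shows "chain R k (open_word Cl s f) \<longleftrightarrow> (\<exists>js. length js = k \<and> set js \<subseteq> Cl \<and> sorted_wrt (>) js \<and>
    sorted_wrt R (map f js) \<and> (\<forall>c\<in>set js. s \<le> c \<and> f c < s))"
proof -
  define L where "L = filter (\<lambda>c. f c < s) (rev (sorted_list_of_set (Cl \<inter> {s..})))"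
  have w: "open_word Cl s f = map f L" by (simp add: open_word_def L_def filter_map comp_def)
  have L: "set L = {c \<in> Cl. s \<le> c \<and> f c < s}" "sorted_wrt (>) L"
    using assms by (auto simp: L_def sorted_wrt_filter sorted_wrt_rev)
  show ?thesis
  proof
    assume "chain R k (open_word Cl s f)"
    then obtain v where v: "subseq v (map f L)" "sorted_wrt R v" "length v = k"
      by (auto simp: chain_def w)
    obtain js where js: "subseq js L" "v = map f js" using subseq_mapE[OF v(1)] .
    show "\<exists>js. length js = k \<and> set js \<subseteq> Cl \<and> sorted_wrt (>) js \<and>
        sorted_wrt R (map f js) \<and> (\<forall>c\<in>set js. s \<le> c \<and> f c < s)"
      using v js subseq_set[OF js(1)] sorted_wrt_subseq[OF js(1) L(2)] L(1)
      by (intro exI[of _ js]) auto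
  next
    assume "\<exists>js. length js = k \<and> set js \<subseteq> Cl \<and> sorted_wrt (>) js \<and>
        sorted_wrt R (map f js) \<and> (\<forall>c\<in>set js. s \<le> c \<and> f c < s)"
    then obtain js where js: "length js = k" "set js \<subseteq> Cl" "sorted_wrt (>) js" "sorted_wrt R (map f js)"
      "\<forall>c\<in>set js. s \<le> c \<and> f c < s" by blast
    have "subseq js L" using js L by (intro subseq_if_decreasing) auto
    then have "subseq (map f js) (map f L)" by (rule subseq_map)
    then show "chain R k (open_word Cl s f)"
      unfolding chain_def w using js by (intro exI[of _ "map f js"]) simp
  qed
qed

text \<open>
  A point that both closes and opens an arc closes first, so the opener \<open>i\<close> is placed at time
  \<open>2 * i + 1\<close> and the closer \<open>j\<close> at time \<open>2 * j\<close>.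
\<close>

definition arcs_of :: "nat set \<Rightarrow> (nat \<Rightarrow> nat) \<Rightarrow> arc set" where
  "arcs_of C f = (\<lambda>j. (f (2 * j) div 2, j)) ` C"

lemma partial_doubled:
  assumes "f \<in> partial ((\<lambda>i. 2 * i + 1) ` O') ((*) 2 ` C) 0" "j \<in> C"
  shows "2 * (f (2 * j) div 2) + 1 = f (2 * j)" "f (2 * j) div 2 \<in> O'" "f (2 * j) div 2 < j"
proof -
  have *: "f (2 * j) \<in> (\<lambda>i. 2 * i + 1) ` O'" "f (2 * j) < 2 * j" using assms by (auto simp: partial_def)
  then obtain i where i: "f (2 * j) = 2 * i + 1" "i \<in> O'" by blast
  then show "2 * (f (2 * j) div 2) + 1 = f (2 * j)" "f (2 * j) div 2 \<in> O'" by simp_all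
  show "f (2 * j) div 2 < j" using i *(2) by simp
qed

text \<open>All openers of a list of arcs precede all its closers exactly if at some time all these
  arcs are open. The assumption on \<open>R\<close> carries comparisons of openers over to the
  doubled time axis.\<close>

lemma chain_open_word_arcs_of:
  assumes f: "f \<in> partial ((\<lambda>i. 2 * i + 1) ` O') ((*) 2 ` C) 0" and "finite C"
    and R: "\<And>a b. R (2 * a + 1) (2 * b + 1) \<longleftrightarrow> R a b"
  shows "(\<exists>s. chain R k (open_word ((*) 2 ` C) s f)) \<longleftrightarrow> arc_pattern R k (arcs_of C f)"
proof
  assume "\<exists>s. chain R k (open_word ((*) 2 ` C) s f)"
  then obtain s where "chain R k (open_word ((*) 2 ` C) s f)" by blast
  then obtain js where js: "length js = k" "set js \<subseteq> (*) 2 ` C" "sorted_wrt (>) js"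
      "sorted_wrt R (map f js)" "\<forall>c\<in>set js. s \<le> c \<and> f c < s"
    unfolding chain_open_word_iff[OF finite_imageI[OF \<open>finite C\<close>]] by blast
  define as where "as = map (\<lambda>c. (f c div 2, c div 2)) js"
  have c: "2 * (f c div 2) + 1 = f c \<and> 2 * (c div 2) = c \<and> c div 2 \<in> C" if "c \<in> set js" for c
  proof -
    obtain j where "j \<in> C" "c = 2 * j" using \<open>c \<in> set js\<close> js(2) by blast
    then show ?thesis using partial_doubled(1)[OF f \<open>j \<in> C\<close>] by simp
  qed
  have "sorted_wrt (\<lambda>a b. R (f a) (f b)) js" using js(4) by (simp add: sorted_wrt_map)
  then have "sorted_wrt (\<lambda>a b. R (f a div 2) (f b div 2)) js"
    by (rule sorted_wrt_mono_rel[rotated]) (use c R in metis)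
  then have "sorted_wrt R (map fst as)" by (simp add: as_def sorted_wrt_map)
  moreover have "sorted_wrt (\<lambda>a b. a div 2 > b div 2) js"
    using js(3) by (rule sorted_wrt_mono_rel[rotated]) (use c in force)
  then have "sorted_wrt (>) (map snd as)" by (simp add: as_def sorted_wrt_map)
  moreover have "set as \<subseteq> arcs_of C f"
  proof
    fix a assume "a \<in> set as"
    then obtain e where e: "e \<in> set js" "a = (f e div 2, e div 2)" by (auto simp: as_def)
    then show "a \<in> arcs_of C f" using c[OF e(1)] unfolding arcs_of_def
      by (intro image_eqI[of _ _ "e div 2"]) auto
  qed
  moreover have "\<forall>a\<in>set as. \<forall>b\<in>set as. fst a < snd b"
  proof (intro ballI)
    fix a b assume "a \<in> set as" "b \<in> set as"
    then obtain d e where "d \<in> set js" "e \<in> set js" "a = (f d div 2, d div 2)" "b = (f e div 2, e div 2)"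
      by (auto simp: as_def)
    moreover have "f d < e" using js(5) calculation by (meson less_le_trans)
    ultimately show "fst a < snd b" using c[of d] c[of e] by auto
  qed
  ultimately show "arc_pattern R k (arcs_of C f)"
    unfolding arc_pattern_def using js(1) by (intro exI[of _ as]) (simp add: as_def)
next
  assume "arc_pattern R k (arcs_of C f)"
  then obtain as where as: "length as = k" "set as \<subseteq> arcs_of C f" "sorted_wrt R (map fst as)"
      "sorted_wrt (>) (map snd as)" "\<forall>a\<in>set as. \<forall>b\<in>set as. fst a < snd b"
    by (auto simp: arc_pattern_def)
  define js where "js = map (\<lambda>a. 2 * snd a) as"
  have c: "f (2 * snd a) = 2 * fst a + 1 \<and> snd a \<in> C" if "a \<in> set as" for a
    using that as(2) partial_doubled(1)[OF f] by (auto simp: arcs_of_def)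
  have "sorted_wrt (\<lambda>a b. R (fst a) (fst b)) as" using as(3) by (simp add: sorted_wrt_map)
  then have "sorted_wrt (\<lambda>a b. R (f (2 * snd a)) (f (2 * snd b))) as"
    by (rule sorted_wrt_mono_rel[rotated]) (use c R in metis)
  then have "sorted_wrt R (map f js)" by (simp add: js_def sorted_wrt_map)
  moreover have "sorted_wrt (>) js" using as(4) by (simp add: js_def sorted_wrt_map)
  moreover have "set js \<subseteq> (*) 2 ` C" using c by (auto simp: js_def)
  moreover have "\<exists>s. \<forall>c\<in>set js. s \<le> c \<and> f c < s"
  proof (cases "as = []")
    case False
    \<comment> \<open>The time \<open>2 * m\<close> of the smallest closer works for all arcs: their
      openers \<open>i < m\<close> sit at \<open>2 * i + 1 < 2 * m\<close>.\<close>
    define m where "m = Min (snd ` set as)"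
    have "m \<in> snd ` set as" unfolding m_def using False by (intro Min_in) auto
    then have "\<forall>a\<in>set as. fst a < m" using as(5) by auto
    moreover have "\<forall>a\<in>set as. m \<le> snd a" unfolding m_def by auto
    ultimately show ?thesis using c by (intro exI[of _ "2 * m"]) (force simp: js_def)
  qed (simp add: js_def)
  ultimately show "\<exists>s. chain R k (open_word ((*) 2 ` C) s f)"
    using chain_open_word_iff[of "(*) 2 ` C" R k] \<open>finite C\<close> as(1) js_def by (metis finite_imageI length_map)
qed

definition matchings :: "nat set \<Rightarrow> nat set \<Rightarrow> arc set set" where
  "matchings O' C = {M. matching M \<and> fst ` M = O' \<and> snd ` M = C}"

lemma bij_betw_arcs_of:
  assumes "finite C"
  shows "bij_betw (arcs_of C) (partial ((\<lambda>i. 2 * i + 1) ` O') ((*) 2 ` C) 0) (matchings O' C)"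
    (is "bij_betw _ ?P _")
  unfolding bij_betw_def
proof
  show "inj_on (arcs_of C) ?P"
  proof (rule inj_onI)
    fix f g assume f: "f \<in> ?P" and g: "g \<in> ?P" and eq: "arcs_of C f = arcs_of C g"
    have "f (2 * j) = g (2 * j)" if "j \<in> C" for j
    proof -
      have "(f (2 * j) div 2, j) \<in> arcs_of C g" using that eq by (auto simp: arcs_of_def)
      then have "f (2 * j) div 2 = g (2 * j) div 2" by (auto simp: arcs_of_def)
      then show ?thesis using partial_doubled(1)[OF f that] partial_doubled(1)[OF g that] by metis
    qed
    then have "f c = g c" if "c \<in> (*) 2 ` C" for c using that by auto
    moreover have "f \<in> (*) 2 ` C \<rightarrow>\<^sub>E (\<lambda>i. 2 * i + 1) ` O'" "g \<in> (*) 2 ` C \<rightarrow>\<^sub>E (\<lambda>i. 2 * i + 1) ` O'"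
      using f g by (simp_all add: partial_def)
    ultimately show "f = g" using PiE_ext by metis
  qed
  show "arcs_of C ` ?P = matchings O' C"
  proof
    show "arcs_of C ` ?P \<subseteq> matchings O' C"
    proof clarify
      fix f assume f: "f \<in> ?P"
      have inj: "inj_on f ((*) 2 ` C)" and sur: "(\<lambda>i. 2 * i + 1) ` O' \<subseteq> f ` (*) 2 ` C"
        using f by (auto simp: partial_def)
      have "j = j'" if "j \<in> C" "j' \<in> C" "f (2 * j) div 2 = f (2 * j') div 2" for j j'
        using partial_doubled(1)[OF f that(1)] partial_doubled(1)[OF f that(2)] that inj_onD[OF inj, of "2 * j" "2 * j'"]
        by auto
      then have "inj_on fst (arcs_of C f)" by (auto simp: inj_on_def arcs_of_def)
      moreover have "inj_on snd (arcs_of C f)" by (auto simp: inj_on_def arcs_of_def)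
      moreover have "snd ` arcs_of C f = C" by (auto simp: arcs_of_def image_image)
      moreover have "\<forall>a\<in>arcs_of C f. fst a < snd a" using partial_doubled(3)[OF f] by (auto simp: arcs_of_def)
      moreover have "fst ` arcs_of C f = O'"
      proof
        show "fst ` arcs_of C f \<subseteq> O'" using partial_doubled(2)[OF f] by (auto simp: arcs_of_def)
        show "O' \<subseteq> fst ` arcs_of C f"
        proof
          fix i assume "i \<in> O'"
          then have "2 * i + 1 \<in> f ` (*) 2 ` C" using sur by blast
          then obtain j where "j \<in> C" "f (2 * j) = 2 * i + 1" by force
          then show "i \<in> fst ` arcs_of C f" unfolding arcs_of_def image_image
            by (intro image_eqI[of _ _ j]) simp_all
        qed
      qed
      moreover have "finite (arcs_of C f)" using assms by (simp add: arcs_of_def)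
      ultimately show "arcs_of C f \<in> matchings O' C" by (simp add: matchings_def matching_def)
    qed
    show "matchings O' C \<subseteq> arcs_of C ` ?P"
    proof
      fix M assume "M \<in> matchings O' C"
      then have M: "inj_on fst M" "inj_on snd M" "\<forall>a\<in>M. fst a < snd a" "fst ` M = O'" "snd ` M = C"
        by (auto simp: matchings_def matching_def)
      define p where "p j = inv_into M snd j" for j
      have p: "p j \<in> M" "snd (p j) = j" if "j \<in> C" for j
        using that M(5) by (auto simp: p_def inv_into_into f_inv_into_f)
      have p': "p (snd a) = a" if "a \<in> M" for a using that M(2) by (simp add: p_def)
      \<comment> \<open>Inverse map: the closer at time \<open>2 * j\<close> gets the opener of the
        arc of \<open>M\<close> ending in \<open>j\<close>, moved to its odd time.\<close>
      define f where "f = restrict (\<lambda>c. 2 * fst (p (c div 2)) + 1) ((*) 2 ` C)"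
      have f: "f (2 * j) = 2 * fst (p j) + 1" if "j \<in> C" for j using that by (simp add: f_def)
      have "f \<in> (*) 2 ` C \<rightarrow>\<^sub>E (\<lambda>i. 2 * i + 1) ` O'"
        using p M(4) by (auto simp: f_def)
      moreover have "inj_on f ((*) 2 ` C)"
      proof (rule inj_onI)
        fix c d assume "c \<in> (*) 2 ` C" "d \<in> (*) 2 ` C" "f c = f d"
        then obtain i j where ij: "i \<in> C" "j \<in> C" "c = 2 * i" "d = 2 * j" "fst (p i) = fst (p j)"
          using f by auto
        then have "p i = p j" using M(1) p(1) by (meson inj_onD)
        then show "c = d" using ij p(2) by metis
      qed
      moreover have "\<forall>c\<in>(*) 2 ` C. f c < c"
      proof clarify
        fix j assume j: "j \<in> C"
        have "fst (p j) < j" using M(3) p[OF j] by metis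
        then show "f (2 * j) < 2 * j" using f[OF j] by simp
      qed
      moreover have "(\<lambda>i. 2 * i + 1) ` O' \<subseteq> f ` (*) 2 ` C"
      proof clarify
        fix i assume "i \<in> O'"
        then obtain a where a: "a \<in> M" "i = fst a" using M(4) by auto
        then have "snd a \<in> C" using M(5) by auto
        then have "f (2 * snd a) = 2 * i + 1" using f p'[OF a(1)] a(2) by simp
        then show "2 * i + 1 \<in> f ` (*) 2 ` C" using \<open>snd a \<in> C\<close> by (metis imageI)
      qed
      ultimately have "f \<in> ?P" by (simp add: partial_def)
      moreover have "arcs_of C f = M"
      proof -
        have "arcs_of C f = (\<lambda>j. (fst (p j), j)) ` C" unfolding arcs_of_def using f by (intro image_cong) auto
        also have "\<dots> = p ` C" using p(2) by (intro image_cong) (auto simp: prod_eq_iff)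
        also have "\<dots> = (\<lambda>a. p (snd a)) ` M" by (simp add: M(5)[symmetric] image_image)
        also have "\<dots> = M" using p' by simp
        finally show ?thesis .
      qed
      ultimately show "M \<in> arcs_of C ` ?P" by blast
    qed
  qed
qed

lemma bij_betw_Collect_conj:
  assumes "bij_betw h A B" "\<And>a. a \<in> A \<Longrightarrow> Q (h a) \<longleftrightarrow> P a"
  shows "bij_betw h {a \<in> A. P a} {b \<in> B. Q b}"
  unfolding bij_betw_def
proof
  show "inj_on h {a \<in> A. P a}" using assms(1) by (auto simp: bij_betw_def intro: inj_on_subset)
  show "h ` {a \<in> A. P a} = {b \<in> B. Q b}"
    using assms by (auto simp: bij_betw_def)
qed

lemma matchings_swap:
  assumes "finite O'" "finite C"
  shows "\<exists>h. bij_betw h {M \<in> matchings O' C. \<not> nests j M \<and> \<not> crosses k M}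
    {M \<in> matchings O' C. \<not> nests k M \<and> \<not> crosses j M}"
proof -
  let ?O = "(\<lambda>i. 2 * i + 1) ` O'" and ?C = "(*) 2 ` C"
  \<comment> \<open>Odd and even times give the disjointness assumed for the walk even if
    \<open>O'\<close> and \<open>C\<close> meet.\<close>
  have "2 * a + 1 \<noteq> 2 * b" for a b :: nat by presburger
  then have disj: "?O \<inter> ?C = {}" by blast
  have iff: "\<not> nests j (arcs_of C f) \<and> \<not> crosses k (arcs_of C f) \<longleftrightarrow>
      (\<forall>s. \<not> chain (<) j (open_word ?C s f) \<and> \<not> chain (>) k (open_word ?C s f))"
    if "f \<in> partial ?O ?C 0" for f j k
    using chain_open_word_arcs_of[OF that assms(2), of "(<)" j] chain_open_word_arcs_of[OF that assms(2), of "(>)" k]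
    unfolding nests_iff_arc_pattern crosses_iff_arc_pattern by auto
  have "bij_betw (arcs_of C)
      {f \<in> partial ?O ?C 0. \<forall>s. \<not> chain (<) j (open_word ?C s f) \<and> \<not> chain (>) k (open_word ?C s f)}
      {M \<in> matchings O' C. \<not> nests j M \<and> \<not> crosses k M}" for j k
    using bij_betw_arcs_of[OF assms(2)] iff by (rule bij_betw_Collect_conj)
  then show ?thesis
    using bij_betw_conjugate[OF chain_free_swap[of ?O ?C j k]] assms disj by blast
qed

section \<open>Partitions and their arcs\<close>

lemma arcs_memE:
  assumes "(i, j) \<in> arcs P"
  obtains B where "B \<in> P" "i \<in> B" "j \<in> B" "i < j" "\<And>l. l \<in> B \<Longrightarrow> i < l \<Longrightarrow> j \<le> l"
  using assms unfolding arcs_def by blast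

lemma partition_on_same_block:
  "partition_on A P \<Longrightarrow> B \<in> P \<Longrightarrow> B' \<in> P \<Longrightarrow> x \<in> B \<Longrightarrow> x \<in> B' \<Longrightarrow> B = B'"
  unfolding partition_on_def disjoint_def by blast

lemma partition_on_blockE:
  assumes "partition_on A P" "x \<in> A"
  obtains B where "B \<in> P" "x \<in> B"
  using assms unfolding partition_on_def by blast

lemma finite_block: "partition_on {1..n::nat} P \<Longrightarrow> B \<in> P \<Longrightarrow> finite B"
  using finite_subset[of B "{1..n}"] by (auto simp: partition_on_def)

lemma arc_from:
  assumes "partition_on {1..n} P" "B \<in> P" "i \<in> B" "l \<in> B" "i < l"
  obtains m where "(i, m) \<in> arcs P" "m \<in> B" "i < m" "m \<le> l"
proof -
  have fin: "finite {l \<in> B. i < l}" "{l \<in> B. i < l} \<noteq> {}" using finite_block[OF assms(1,2)] assms(4,5) by auto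
  define m where "m = Min {l \<in> B. i < l}"
  have m: "m \<in> {l \<in> B. i < l}" unfolding m_def using Min_in[OF fin] .
  have le: "m \<le> l'" if "l' \<in> B" "i < l'" for l' unfolding m_def using fin that by (intro Min_le) auto
  have "(i, m) \<in> arcs P" using m le assms(2,3) unfolding arcs_def by auto
  then show ?thesis using that m le assms(4,5) by blast
qed

lemma arc_to:
  assumes "partition_on {1..n} P" "B \<in> P" "j \<in> B" "l \<in> B" "l < j"
  obtains m where "(m, j) \<in> arcs P"
proof -
  have fin: "finite {l \<in> B. l < j}" "{l \<in> B. l < j} \<noteq> {}" using finite_block[OF assms(1,2)] assms(4,5) by auto
  define m where "m = Max {l \<in> B. l < j}"
  have m: "m \<in> {l \<in> B. l < j}" unfolding m_def using Max_in[OF fin] .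
  have le: "l' \<le> m" if "l' \<in> B" "l' < j" for l' unfolding m_def using fin that by (intro Max_ge) auto
  have "j \<le> l'" if "l' \<in> B" "m < l'" for l' using le[OF that(1)] that(2) by (meson not_le)
  then have "(m, j) \<in> arcs P" using m assms(2,3) unfolding arcs_def by auto
  then show ?thesis using that by blast
qed

lemma matching_arcs:
  assumes "partition_on {1..n} P"
  shows "matching (arcs P)"
  unfolding matching_def
proof (intro conjI)
  show "finite (arcs P)" using arcs_subset[OF assms] by (rule finite_subset) simp
  show "\<forall>a\<in>arcs P. fst a < snd a" by (auto simp: arcs_def)
  have 1: "j = j'" if "(i, j) \<in> arcs P" "(i, j') \<in> arcs P" for i j j'
    using that by (elim arcs_memE) (metis assms partition_on_same_block order_antisym)
  show "inj_on fst (arcs P)"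
  proof (rule inj_onI)
    fix a b assume "a \<in> arcs P" "b \<in> arcs P" "fst a = fst b"
    then show "a = b" using 1[of "fst a" "snd a" "snd b"] by (metis prod.collapse)
  qed
  have 2: "\<not> i < i'" if "(i, j) \<in> arcs P" "(i', j) \<in> arcs P" for i i' j
    using that by (elim arcs_memE) (metis assms partition_on_same_block not_le)
  show "inj_on snd (arcs P)"
  proof (rule inj_onI)
    fix a b assume "a \<in> arcs P" "b \<in> arcs P" "snd a = snd b"
    then show "a = b" using 2[of "fst a" "snd a" "fst b"] 2[of "fst b" "snd b" "fst a"]
      by (metis prod.collapse linorder_neqE_nat)
  qed
qed

text \<open>An element has an arc to its successor unless it is the maximum of its block, so
  prescribing the maxima prescribes the openers.\<close>

lemma fst_arcs:
  assumes "partition_on {1..n} P"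
  shows "fst ` arcs P = {1..n} - block_maxs P"
proof
  show "fst ` arcs P \<subseteq> {1..n} - block_maxs P"
  proof clarify
    fix i j assume a: "(i, j) \<in> arcs P"
    then obtain B where B: "B \<in> P" "i \<in> B" "j \<in> B" "i < j" by (rule arcs_memE)
    have "i \<in> {1..n}" using arcs_subset[OF assms] a by auto
    moreover have "i \<notin> block_maxs P"
    proof
      assume "i \<in> block_maxs P"
      then obtain B' where B': "B' \<in> P" "i = Max B'" by (auto simp: block_maxs_def)
      have "finite B'" "B' \<noteq> {}" using finite_block[OF assms B'(1)] assms B'(1) by (auto simp: partition_on_def)
      then have "i \<in> B'" "\<forall>l\<in>B'. l \<le> i" using B'(2) by auto
      moreover have "B = B'" using partition_on_same_block[OF assms B(1) B'(1) B(2)] calculation by blast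
      ultimately show False using B by auto
    qed
    ultimately show "fst (i, j) \<in> {1..n} - block_maxs P" by simp
  qed
  show "{1..n} - block_maxs P \<subseteq> fst ` arcs P"
  proof
    fix i assume i: "i \<in> {1..n} - block_maxs P"
    obtain B where B: "B \<in> P" "i \<in> B" using partition_on_blockE[OF assms DiffD1[OF i]] .
    have fB: "finite B" using finite_block[OF assms B(1)] .
    have "i \<noteq> Max B" using i B(1) by (auto simp: block_maxs_def)
    then have "i < Max B" using fB B(2) by (simp add: order.strict_iff_order)
    moreover have "Max B \<in> B" using Max_in[OF fB] B(2) by blast
    ultimately obtain m where "(i, m) \<in> arcs P" using arc_from[OF assms B] by metis
    then show "i \<in> fst ` arcs P" by force
  qed
qed

lemma snd_arcs:
  assumes "partition_on {1..n} P"
  shows "snd ` arcs P = {1..n} - block_mins P"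
proof
  show "snd ` arcs P \<subseteq> {1..n} - block_mins P"
  proof clarify
    fix i j assume a: "(i, j) \<in> arcs P"
    then obtain B where B: "B \<in> P" "i \<in> B" "j \<in> B" "i < j" by (rule arcs_memE)
    have "j \<in> {1..n}" using arcs_subset[OF assms] a by auto
    moreover have "j \<notin> block_mins P"
    proof
      assume "j \<in> block_mins P"
      then obtain B' where B': "B' \<in> P" "j = Min B'" by (auto simp: block_mins_def)
      have "finite B'" "B' \<noteq> {}" using finite_block[OF assms B'(1)] assms B'(1) by (auto simp: partition_on_def)
      then have "j \<in> B'" "\<forall>l\<in>B'. j \<le> l" using B'(2) by auto
      moreover have "B = B'" using partition_on_same_block[OF assms B(1) B'(1) B(3)] calculation by blast
      ultimately show False using B by auto
    qed
    ultimately show "snd (i, j) \<in> {1..n} - block_mins P" by simp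
  qed
  show "{1..n} - block_mins P \<subseteq> snd ` arcs P"
  proof
    fix i assume i: "i \<in> {1..n} - block_mins P"
    obtain B where B: "B \<in> P" "i \<in> B" using partition_on_blockE[OF assms DiffD1[OF i]] .
    have fB: "finite B" using finite_block[OF assms B(1)] .
    have "i \<noteq> Min B" using i B(1) by (auto simp: block_mins_def)
    then have "Min B < i" using fB B(2) by (simp add: order.strict_iff_order)
    moreover have "Min B \<in> B" using Min_in[OF fB] B(2) by blast
    ultimately obtain m where "(m, i) \<in> arcs P" using arc_to[OF assms B] by metis
    then show "i \<in> snd ` arcs P" by force
  qed
qed

lemma block_extrema_subset:
  assumes "partition_on {1..n} P"
  shows "block_mins P \<subseteq> {1..n}" "block_maxs P \<subseteq> {1..n}"
proof -
  have "Min B \<in> {1..n} \<and> Max B \<in> {1..n}" if "B \<in> P" for B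
  proof -
    have "finite B" "B \<noteq> {}" "B \<subseteq> {1..n}"
      using finite_block[OF assms that] assms that by (auto simp: partition_on_def)
    then show ?thesis using Min_in Max_in by blast
  qed
  then show "block_mins P \<subseteq> {1..n}" "block_maxs P \<subseteq> {1..n}"
    by (auto simp: block_mins_def block_maxs_def)
qed

text \<open>No symmetric closure is taken: arcs join consecutive elements, so a block is a single
  directed path, and of two of its elements one reaches the other.\<close>

definition block_of :: "nat \<Rightarrow> arc set \<Rightarrow> nat \<Rightarrow> nat set" where
  "block_of n A x = {y \<in> {1..n}. (x, y) \<in> A\<^sup>* \<or> (y, x) \<in> A\<^sup>*}"

lemma rtrancl_arcs:
  assumes "partition_on {1..n} P" "B \<in> P" "i \<in> B"
  shows "(i, j) \<in> (arcs P)\<^sup>* \<longleftrightarrow> j \<in> B \<and> i \<le> j"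
proof
  assume "(i, j) \<in> (arcs P)\<^sup>*"
  then show "j \<in> B \<and> i \<le> j"
  proof (induction rule: rtrancl_induct)
    case (step y z)
    obtain B' where "B' \<in> P" "y \<in> B'" "z \<in> B'" "y < z" using step(2) by (rule arcs_memE)
    moreover have "B = B'" using partition_on_same_block[OF assms(1,2)] calculation step(3) by blast
    ultimately show ?case using step(3) by auto
  qed (use assms in simp)
next
  assume "j \<in> B \<and> i \<le> j"
  then show "(i, j) \<in> (arcs P)\<^sup>*" using assms(3)
  proof (induction "j - i" arbitrary: i rule: less_induct)
    case less
    show ?case
    proof (cases "i = j")
      case False
      then have "i < j" using less by auto
      then obtain m where m: "(i, m) \<in> arcs P" "m \<in> B" "i < m" "m \<le> j"
        using arc_from[OF assms(1,2) less.prems(2)] less.prems(1) by metis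
      then have "(m, j) \<in> (arcs P)\<^sup>*" using less.hyps[of m] less.prems by auto
      then show ?thesis using m(1) by (rule converse_rtrancl_into_rtrancl[rotated])
    qed simp
  qed
qed

text \<open>Recovers a partition from its arcs alone. Singleton blocks carry no arc and come from
  the reflexivity of the closure.\<close>

lemma partition_eq_blocks:
  assumes "partition_on {1..n} P"
  shows "P = block_of n (arcs P) ` {1..n}"
proof -
  have B: "block_of n (arcs P) x = B" if "B \<in> P" "x \<in> B" for x B
  proof -
    have "y \<in> block_of n (arcs P) x \<longleftrightarrow> y \<in> B" for y
    proof (cases "y \<in> {1..n}")
      case True
      obtain B' where B': "B' \<in> P" "y \<in> B'" using partition_on_blockE[OF assms True] .
      then have "x \<in> B' \<longleftrightarrow> y \<in> B" using partition_on_same_block[OF assms] that by metis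
      then show ?thesis
        using rtrancl_arcs[OF assms that] rtrancl_arcs[OF assms B'] True by (auto simp: block_of_def)
    next
      case False
      then show ?thesis using that(1) assms by (auto simp: block_of_def partition_on_def)
    qed
    then show ?thesis by blast
  qed
  show ?thesis
  proof
    show "P \<subseteq> block_of n (arcs P) ` {1..n}"
    proof
      fix C assume C: "C \<in> P"
      then have "C \<noteq> {}" using assms by (auto simp: partition_on_def)
      then obtain x where x: "x \<in> C" by blast
      moreover have "x \<in> {1..n}" using C x assms by (auto simp: partition_on_def)
      ultimately show "C \<in> block_of n (arcs P) ` {1..n}" using B[OF C x] by blast
    qed
    show "block_of n (arcs P) ` {1..n} \<subseteq> P"
    proof clarify
      fix x assume "x \<in> {1..n}"
      then obtain C where "C \<in> P" "x \<in> C" by (rule partition_on_blockE[OF assms])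
      then show "block_of n (arcs P) x \<in> P" using B by simp
    qed
  qed
qed

text \<open>Distinct openers and distinct closers make \<open>A\<close> single-valued in both
  directions, so its components are paths. Reachability one way or the other is then an equivalence
  relation, and its classes are the blocks.\<close>

lemma partition_of_matching:
  assumes "matching A" "A \<subseteq> {1..n} \<times> {1..n}"
  shows "\<exists>P. partition_on {1..n} P \<and> arcs P = A"
proof -
  define sim where "sim x y \<longleftrightarrow> (x, y) \<in> A\<^sup>* \<or> (y, x) \<in> A\<^sup>*" for x y
  have fst_eq: "y = z" if "(x, y) \<in> A" "(x, z) \<in> A" for x y z
    using assms(1) that unfolding matching_def inj_on_def by fastforce
  have snd_eq: "y = z" if "(y, x) \<in> A" "(z, x) \<in> A" for x y z
    using assms(1) that unfolding matching_def inj_on_def by fastforce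
  have sv: "single_valued A" using fst_eq by (auto simp: single_valued_def)
  have sv': "single_valued (A\<inverse>)" using snd_eq by (auto simp: single_valued_def)
  \<comment> \<open>Of two paths with a common start one extends the other; the next fact says the
    same for a common end.\<close>
  have conf: "sim y z" if "(x, y) \<in> A\<^sup>*" "(x, z) \<in> A\<^sup>*" for x y z
    using single_valued_confluent[OF sv that] by (auto simp: sim_def)
  have conf': "sim y z" if "(y, x) \<in> A\<^sup>*" "(z, x) \<in> A\<^sup>*" for x y z
    using single_valued_confluent[OF sv', of x y z] that by (auto simp: sim_def rtrancl_converse)
  have sym: "sim y x" if "sim x y" for x y using that by (auto simp: sim_def)
  have trans: "sim x z" if "sim x y" "sim y z" for x y z
    using that conf conf' rtrancl_trans[of _ _ A] by (metis sim_def)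
  have mono: "x \<le> y" if "(x, y) \<in> A\<^sup>*" for x y
    using that
  proof (induction rule: rtrancl_induct)
    case (step y z)
    then have "y < z" using assms(1) by (force simp: matching_def)
    then show ?case using step by simp
  qed simp
  have blk: "block_of n A x = {y \<in> {1..n}. sim x y}" for x by (simp add: block_of_def sim_def)
  define P where "P = block_of n A ` {1..n}"
  have "partition_on {1..n} P"
    unfolding partition_on_def disjoint_def
  proof (intro conjI ballI impI)
    have x: "x \<in> block_of n A x" if "x \<in> {1..n}" for x using that by (simp add: block_of_def)
    show "\<Union>P = {1..n}"
    proof
      show "\<Union>P \<subseteq> {1..n}" by (auto simp: P_def block_of_def)
      show "{1..n} \<subseteq> \<Union>P" using x unfolding P_def by blast
    qed
    show "{} \<notin> P" using x unfolding P_def by blast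
    fix B B' assume "B \<in> P" "B' \<in> P" "B \<noteq> B'"
    then obtain x y where xy: "B = block_of n A x" "B' = block_of n A y" by (auto simp: P_def)
    show "B \<inter> B' = {}"
    proof (rule ccontr)
      assume "B \<inter> B' \<noteq> {}"
      then obtain z where "sim x z" "sim y z" using xy blk by auto
      then have "sim x y" using sym trans by blast
      then have "B = B'" unfolding xy blk using sym trans by blast
      then show False using \<open>B \<noteq> B'\<close> by blast
    qed
  qed
  moreover have "arcs P = A"
  proof
    show "arcs P \<subseteq> A"
    proof clarify
      fix i j assume "(i, j) \<in> arcs P"
      then obtain B where B: "B \<in> P" "i \<in> B" "j \<in> B" "i < j" "\<And>l. l \<in> B \<Longrightarrow> i < l \<Longrightarrow> j \<le> l"
        by (rule arcs_memE) blast
      obtain x where x: "B = block_of n A x" using B(1) by (auto simp: P_def)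
      have "sim i j" using B(2,3) x blk sym trans by blast
      then have "(i, j) \<in> A\<^sup>*" using B(4) mono[of j i] by (auto simp: sim_def)
      \<comment> \<open>The first step of the path from \<open>i\<close> to \<open>j\<close> stays
        in the block, so minimality of \<open>j\<close> gives \<open>j \<le> m\<close>; entries
        increase along the path, so \<open>m \<le> j\<close>.\<close>
      then obtain m where m: "(i, m) \<in> A" "(m, j) \<in> A\<^sup>*" using B(4) by (metis converse_rtranclE less_irrefl)
      have "sim i m" using m(1) by (auto simp: sim_def)
      then have "m \<in> B" using m(1) assms(2) B(2) x blk trans by blast
      moreover have "i < m" using m(1) assms(1) by (force simp: matching_def)
      ultimately have "j \<le> m" using B(5) by blast
      then have "j = m" using mono[OF m(2)] by simp
      then show "(i, j) \<in> A" using m(1) by simp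
    qed
    show "A \<subseteq> arcs P"
    proof clarify
      fix i j assume ij: "(i, j) \<in> A"
      then have lt: "i < j" "i \<in> {1..n}" "j \<in> {1..n}" using assms by (force simp: matching_def)+
      have "j \<le> l" if l: "l \<in> block_of n A i" "i < l" for l
      proof -
        have "(i, l) \<in> A\<^sup>*" using l mono[of l i] by (auto simp: block_of_def)
        then obtain m where "(i, m) \<in> A" "(m, l) \<in> A\<^sup>*" using l(2) by (metis converse_rtranclE less_irrefl)
        then show ?thesis using fst_eq[OF ij] mono by blast
      qed
      moreover have "i \<in> block_of n A i" "j \<in> block_of n A i" using lt ij by (auto simp: block_of_def)
      ultimately show "(i, j) \<in> arcs P" using lt unfolding arcs_def P_def by auto
    qed
  qed
  ultimately show ?thesis by blast
qed

section \<open>Color classes\<close>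

lemma arc_pattern_mono:
  assumes "arc_pattern R k M" "l \<le> k"
  shows "arc_pattern R l M"
proof -
  obtain as where as: "length as = k" "set as \<subseteq> M" "sorted_wrt R (map fst as)"
      "sorted_wrt (>) (map snd as)" "\<forall>a\<in>set as. \<forall>b\<in>set as. fst a < snd b"
    using assms(1) by (auto simp: arc_pattern_def)
  have "sorted_wrt R (map fst (take l as))" "sorted_wrt (>) (map snd (take l as))"
    using as(3,4) by (simp_all add: take_map[symmetric] sorted_wrt_take)
  moreover have "set (take l as) \<subseteq> set as" by (rule set_take_subset)
  ultimately show ?thesis using as assms(2)
    unfolding arc_pattern_def by (intro exI[of _ "take l as"]) (simp, blast)
qed

definition color_class :: "colored_partition \<Rightarrow> nat \<Rightarrow> arc set" where
  "color_class \<Lambda> c = {a \<in> arcs (fst \<Lambda>). snd \<Lambda> a = c}"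

text \<open>A nonempty list takes the color of its head. The empty list has no color of its own, and
  \<open>r > 0\<close> supplies one.\<close>

lemma monochromatic_list:
  assumes "r > 0" "\<And>a. a \<in> A \<Longrightarrow> f a \<in> {1..r::nat}"
  shows "set as \<subseteq> A \<and> (\<forall>a\<in>set as. \<forall>b\<in>set as. f a = f b) \<longleftrightarrow>
    (\<exists>c\<in>{1..r}. set as \<subseteq> {a \<in> A. f a = c})"
proof (cases as)
  case Nil
  then show ?thesis using assms(1) by force
next
  case (Cons a bs)
  show ?thesis
  proof
    assume *: "set as \<subseteq> A \<and> (\<forall>a\<in>set as. \<forall>b\<in>set as. f a = f b)"
    then have "f a \<in> {1..r}" using Cons assms(2) by simp
    moreover have "set as \<subseteq> {b \<in> A. f b = f a}" using * Cons by auto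
    ultimately show "\<exists>c\<in>{1..r}. set as \<subseteq> {a \<in> A. f a = c}" by blast
  qed auto
qed

lemma has_crossing_iff:
  assumes "\<Lambda> \<in> colored_partitions n r" "r > 0"
  shows "has_crossing \<Lambda> k \<longleftrightarrow> (\<exists>c\<in>{1..r}. crosses k (color_class \<Lambda> c))"
proof -
  have "snd \<Lambda> a \<in> {1..r}" if "a \<in> arcs (fst \<Lambda>)" for a
    using assms(1) that by (auto simp: colored_partitions_def)
  note * = monochromatic_list[where f = "snd \<Lambda>" and A = "arcs (fst \<Lambda>)", OF assms(2) this]
  have "has_crossing \<Lambda> k \<longleftrightarrow> (\<exists>as. length as = k \<and> sorted_wrt (<) (map fst as @ map snd as) \<and>
      (set as \<subseteq> arcs (fst \<Lambda>) \<and> (\<forall>a\<in>set as. \<forall>b\<in>set as. snd \<Lambda> a = snd \<Lambda> b)))"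
    unfolding has_crossing_def crossing_def by blast
  also have "\<dots> \<longleftrightarrow> (\<exists>as. length as = k \<and> sorted_wrt (<) (map fst as @ map snd as) \<and>
      (\<exists>c\<in>{1..r}. set as \<subseteq> color_class \<Lambda> c))"
    unfolding color_class_def by (simp only: *)
  also have "\<dots> \<longleftrightarrow> (\<exists>c\<in>{1..r}. crosses k (color_class \<Lambda> c))"
    unfolding crosses_def by blast
  finally show ?thesis .
qed

lemma has_nesting_iff:
  assumes "\<Lambda> \<in> colored_partitions n r" "r > 0"
  shows "has_nesting \<Lambda> k \<longleftrightarrow> (\<exists>c\<in>{1..r}. nests k (color_class \<Lambda> c))"
proof -
  have "snd \<Lambda> a \<in> {1..r}" if "a \<in> arcs (fst \<Lambda>)" for a
    using assms(1) that by (auto simp: colored_partitions_def)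
  note * = monochromatic_list[where f = "snd \<Lambda>" and A = "arcs (fst \<Lambda>)", OF assms(2) this]
  have "has_nesting \<Lambda> k \<longleftrightarrow> (\<exists>as. length as = k \<and> sorted_wrt (<) (map fst as @ rev (map snd as)) \<and>
      (set as \<subseteq> arcs (fst \<Lambda>) \<and> (\<forall>a\<in>set as. \<forall>b\<in>set as. snd \<Lambda> a = snd \<Lambda> b)))"
    unfolding has_nesting_def nesting_def by blast
  also have "\<dots> \<longleftrightarrow> (\<exists>as. length as = k \<and> sorted_wrt (<) (map fst as @ rev (map snd as)) \<and>
      (\<exists>c\<in>{1..r}. set as \<subseteq> color_class \<Lambda> c))"
    unfolding color_class_def by (simp only: *)
  also have "\<dots> \<longleftrightarrow> (\<exists>c\<in>{1..r}. nests k (color_class \<Lambda> c))"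
    unfolding nests_def by blast
  finally show ?thesis .
qed

text \<open>For \<open>j \<le> 0\<close> both sides are false, since \<open>nat j\<close> is 0 and
  \<open>Q 0\<close> holds; this covers negative bounds.\<close>

lemma Max_less_iff_not_nat:
  fixes j :: int
  assumes "finite {k. Q k}" "Q 0" "\<And>k l. Q k \<Longrightarrow> l \<le> k \<Longrightarrow> Q l"
  shows "int (Max {k. Q k}) < j \<longleftrightarrow> \<not> Q (nat j)"
proof
  assume "int (Max {k. Q k}) < j"
  then show "\<not> Q (nat j)" using Max_ge[OF assms(1), of "nat j"] by auto
next
  assume *: "\<not> Q (nat j)"
  have "Max {k. Q k} \<in> {k. Q k}" using assms(1,2) by (intro Max_in) auto
  then show "int (Max {k. Q k}) < j" using assms(3)[of "Max {k. Q k}" "nat j"] * by (cases "nat j \<le> Max {k. Q k}") auto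
qed

lemma cr_less_iff:
  assumes "\<Lambda> \<in> colored_partitions n r" "r > 0"
  shows "int (cr \<Lambda>) < j \<longleftrightarrow> (\<forall>c\<in>{1..r}. \<not> crosses (nat j) (color_class \<Lambda> c))"
proof -
  have "has_crossing \<Lambda> l" if "has_crossing \<Lambda> k" "l \<le> k" for k l
    using that arc_pattern_mono crosses_iff_arc_pattern unfolding has_crossing_iff[OF assms] by blast
  then have "int (cr \<Lambda>) < j \<longleftrightarrow> \<not> has_crossing \<Lambda> (nat j)"
    unfolding cr_def using finite_has_crossing[OF assms(1)] has_crossing_0 by (intro Max_less_iff_not_nat)
  then show ?thesis unfolding has_crossing_iff[OF assms] by blast
qed

lemma ne_less_iff:
  assumes "\<Lambda> \<in> colored_partitions n r" "r > 0"
  shows "int (ne \<Lambda>) < k \<longleftrightarrow> (\<forall>c\<in>{1..r}. \<not> nests (nat k) (color_class \<Lambda> c))"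
proof -
  have "has_nesting \<Lambda> l" if "has_nesting \<Lambda> k" "l \<le> k" for k l
    using that arc_pattern_mono nests_iff_arc_pattern unfolding has_nesting_iff[OF assms] by blast
  then have "int (ne \<Lambda>) < k \<longleftrightarrow> \<not> has_nesting \<Lambda> (nat k)"
    unfolding ne_def using finite_has_nesting[OF assms(1)] has_nesting_0 by (intro Max_less_iff_not_nat)
  then show ?thesis unfolding has_nesting_iff[OF assms] by blast
qed

text \<open>All conditions depend on a class only through being a matching and through its sets of
  openers and closers, so a class may be exchanged for any other matching with the same two
  sets.\<close>

definition arc_families :: "nat set \<Rightarrow> nat set \<Rightarrow> nat \<Rightarrow> (nat \<Rightarrow> arc set) set" where
  "arc_families O' C r = {F \<in> {1..r} \<rightarrow>\<^sub>E Collect matching.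
     (\<forall>c\<in>{1..r}. \<forall>d\<in>{1..r}. c \<noteq> d \<longrightarrow> fst ` F c \<inter> fst ` F d = {} \<and> snd ` F c \<inter> snd ` F d = {}) \<and>
     (\<Union>c\<in>{1..r}. fst ` F c) = O' \<and> (\<Union>c\<in>{1..r}. snd ` F c) = C}"

definition avoiding :: "nat \<Rightarrow> nat \<Rightarrow> arc set \<Rightarrow> bool" where
  "avoiding j k M \<longleftrightarrow> \<not> crosses j M \<and> \<not> nests k M"

text \<open>One map \<open>h\<close> serves all matchings: a bijection is chosen for every pair of
  finite sets of openers and closers. As \<open>h\<close> preserves this pair, injectivity reduces
  to that for a fixed pair.\<close>

lemma avoiding_swap:
  obtains h where "\<And>M. matching M \<Longrightarrow> avoiding j k M \<Longrightarrow>
      matching (h M) \<and> avoiding k j (h M) \<and> fst ` h M = fst ` M \<and> snd ` h M = snd ` M"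
    and "\<And>M N. matching M \<Longrightarrow> avoiding j k M \<Longrightarrow> matching N \<Longrightarrow> avoiding j k N \<Longrightarrow> h M = h N \<Longrightarrow> M = N"
proof -
  \<comment> \<open>The first number bounds nestings here but crossings in \<open>avoiding\<close>,
    so \<open>X k j\<close> belongs to \<open>avoiding j k\<close>.\<close>
  define X where "X j k O' C = {M \<in> matchings O' C. \<not> nests j M \<and> \<not> crosses k M}" for j k O' C
  have "\<forall>O' C. \<exists>h. finite O' \<and> finite C \<longrightarrow> bij_betw h (X k j O' C) (X j k O' C)"
    unfolding X_def using matchings_swap by blast
  then obtain g where g: "\<And>O' C. finite O' \<Longrightarrow> finite C \<Longrightarrow> bij_betw (g O' C) (X k j O' C) (X j k O' C)"
    by metis
  define h where "h M = g (fst ` M) (snd ` M) M" for M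
  have b: "bij_betw (g (fst ` M) (snd ` M)) (X k j (fst ` M) (snd ` M)) (X j k (fst ` M) (snd ` M))"
    and m: "M \<in> X k j (fst ` M) (snd ` M)" if "matching M" "avoiding j k M" for M
    using that g by (auto simp: X_def matchings_def matching_def avoiding_def)
  have 1: "matching (h M) \<and> avoiding k j (h M) \<and> fst ` h M = fst ` M \<and> snd ` h M = snd ` M"
    if "matching M" "avoiding j k M" for M
  proof -
    have "h M \<in> X j k (fst ` M) (snd ` M)" unfolding h_def using bij_betwE[OF b[OF that]] m[OF that] by blast
    then show ?thesis by (simp add: X_def matchings_def avoiding_def)
  qed
  have 2: "M = N" if "matching M" "avoiding j k M" "matching N" "avoiding j k N" "h M = h N" for M N
  proof -
    have eq: "fst ` M = fst ` N" "snd ` M = snd ` N" using 1[OF that(1,2)] 1[OF that(3,4)] that(5) by metis+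
    have "inj_on (g (fst ` M) (snd ` M)) (X k j (fst ` M) (snd ` M))"
      using b[OF that(1,2)] by (simp add: bij_betw_def)
    then show ?thesis using m[OF that(1,2)] m[OF that(3,4)] that(5) unfolding h_def eq by (meson inj_onD)
  qed
  show ?thesis using that[of h] 1 2 by blast
qed

text \<open>Applying \<open>h\<close> to every color class is injective. An inequality is enough,
  because exchanging \<open>j\<close> and \<open>k\<close> gives the reverse one.\<close>

lemma card_arc_families_le:
  assumes "finite {F \<in> arc_families O' C r. \<forall>c\<in>{1..r}. avoiding k j (F c)}"
  shows "card {F \<in> arc_families O' C r. \<forall>c\<in>{1..r}. avoiding j k (F c)} \<le>
    card {F \<in> arc_families O' C r. \<forall>c\<in>{1..r}. avoiding k j (F c)}"
proof -
  obtain h where h: "\<And>M. matching M \<Longrightarrow> avoiding j k M \<Longrightarrow>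
      matching (h M) \<and> avoiding k j (h M) \<and> fst ` h M = fst ` M \<and> snd ` h M = snd ` M"
    and inj: "\<And>M N. matching M \<Longrightarrow> avoiding j k M \<Longrightarrow> matching N \<Longrightarrow> avoiding j k N \<Longrightarrow> h M = h N \<Longrightarrow> M = N"
    using avoiding_swap[of j k] by blast
  define H where "H F = restrict (\<lambda>c. h (F c)) {1..r}" for F :: "nat \<Rightarrow> arc set"
  show ?thesis
  proof (rule card_inj_on_le[OF _ _ assms])
    show "inj_on H {F \<in> arc_families O' C r. \<forall>c\<in>{1..r}. avoiding j k (F c)}"
    proof (rule inj_onI)
      fix F G
      assume F: "F \<in> {F \<in> arc_families O' C r. \<forall>c\<in>{1..r}. avoiding j k (F c)}"
        and G: "G \<in> {F \<in> arc_families O' C r. \<forall>c\<in>{1..r}. avoiding j k (F c)}" and eq: "H F = H G"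
      have PiE: "F \<in> {1..r} \<rightarrow>\<^sub>E Collect matching" "G \<in> {1..r} \<rightarrow>\<^sub>E Collect matching"
        using F G by (auto simp: arc_families_def)
      have "F c = G c" if c: "c \<in> {1..r}" for c
      proof (rule inj)
        show "matching (F c)" "matching (G c)" using PiE_mem[OF PiE(1) c] PiE_mem[OF PiE(2) c] by simp_all
        show "avoiding j k (F c)" "avoiding j k (G c)" using F G c by blast+
        show "h (F c) = h (G c)" using fun_cong[OF eq, of c] c by (simp add: H_def)
      qed
      then show "F = G" using PiE PiE_ext by metis
    qed
    show "H ` {F \<in> arc_families O' C r. \<forall>c\<in>{1..r}. avoiding j k (F c)} \<subseteq>
        {F \<in> arc_families O' C r. \<forall>c\<in>{1..r}. avoiding k j (F c)}"
    proof clarify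
      fix F assume F: "F \<in> arc_families O' C r" "\<forall>c\<in>{1..r}. avoiding j k (F c)"
      have PiE: "F \<in> {1..r} \<rightarrow>\<^sub>E Collect matching" using F by (simp add: arc_families_def)
      have c: "matching (H F c)" "avoiding k j (H F c)" "fst ` H F c = fst ` F c" "snd ` H F c = snd ` F c"
        if "c \<in> {1..r}" for c
        using h[of "F c"] PiE_mem[OF PiE that] F(2) that by (simp_all add: H_def)
      have "H F \<in> {1..r} \<rightarrow>\<^sub>E Collect matching" using c(1) by (auto simp: H_def)
      moreover have "\<forall>c\<in>{1..r}. \<forall>d\<in>{1..r}. c \<noteq> d \<longrightarrow> fst ` H F c \<inter> fst ` H F d = {} \<and> snd ` H F c \<inter> snd ` H F d = {}"
        using F(1) c(3,4) by (simp add: arc_families_def)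
      moreover have "(\<Union>c\<in>{1..r}. fst ` H F c) = O'" "(\<Union>c\<in>{1..r}. snd ` H F c) = C"
        using F(1) c(3,4) by (simp_all add: arc_families_def)
      ultimately show "H F \<in> arc_families O' C r \<and> (\<forall>c\<in>{1..r}. avoiding k j (H F c))"
        using c(2) by (simp add: arc_families_def)
    qed
  qed
qed

text \<open>For surjectivity, openers and closers of different colors are distinct, so the union of
  a family is again a matching and hence the arc set of a partition. The color of an arc is the
  index of the unique class containing it.\<close>

lemma bij_betw_color_classes:
  assumes "S \<subseteq> {1..n}" "T \<subseteq> {1..n}"
  shows "bij_betw (\<lambda>\<Lambda>. restrict (color_class \<Lambda>) {1..r})
    {\<Lambda> \<in> colored_partitions n r. block_mins (fst \<Lambda>) = S \<and> block_maxs (fst \<Lambda>) = T}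
    (arc_families ({1..n} - T) ({1..n} - S) r)" (is "bij_betw ?f ?A ?B")
  unfolding bij_betw_def
proof
  have col: "partition_on {1..n} (fst \<Lambda>)" "snd \<Lambda> \<in> arcs (fst \<Lambda>) \<rightarrow>\<^sub>E {1..r}" if "\<Lambda> \<in> ?A" for \<Lambda>
    using that by (auto simp: colored_partitions_def)
  have union: "(\<Union>c\<in>{1..r}. color_class \<Lambda> c) = arcs (fst \<Lambda>)" if "\<Lambda> \<in> ?A" for \<Lambda>
    using PiE_mem[OF col(2)[OF that]] by (auto simp: color_class_def)
  show "inj_on ?f ?A"
  proof (rule inj_onI)
    fix \<Lambda> \<Lambda>' assume A: "\<Lambda> \<in> ?A" "\<Lambda>' \<in> ?A" and eq: "?f \<Lambda> = ?f \<Lambda>'"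
    have c: "color_class \<Lambda> c = color_class \<Lambda>' c" if "c \<in> {1..r}" for c
      using fun_cong[OF eq, of c] that by simp
    then have arcs: "arcs (fst \<Lambda>) = arcs (fst \<Lambda>')" using union[OF A(1)] union[OF A(2)] by simp
    then have P: "fst \<Lambda> = fst \<Lambda>'"
      using partition_eq_blocks[OF col(1)[OF A(1)]] partition_eq_blocks[OF col(1)[OF A(2)]] by metis
    have "snd \<Lambda> a = snd \<Lambda>' a" if "a \<in> arcs (fst \<Lambda>)" for a
    proof -
      have "snd \<Lambda> a \<in> {1..r}" using PiE_mem[OF col(2)[OF A(1)] that] .
      then have "a \<in> color_class \<Lambda>' (snd \<Lambda> a)" using c that by (auto simp: color_class_def)
      then show ?thesis by (simp add: color_class_def)
    qed
    then have "snd \<Lambda> = snd \<Lambda>'"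
      using col(2)[OF A(1)] col(2)[OF A(2)] arcs by (metis PiE_ext)
    then show "\<Lambda> = \<Lambda>'" using P by (simp add: prod_eq_iff)
  qed
  show "?f ` ?A = ?B"
  proof
    show "?f ` ?A \<subseteq> ?B"
    proof
      fix F assume "F \<in> ?f ` ?A"
      then obtain \<Lambda> where L: "\<Lambda> \<in> ?A" and F: "F = ?f \<Lambda>" by blast
      have M: "matching (arcs (fst \<Lambda>))" using matching_arcs[OF col(1)[OF L]] .
      then have inj: "inj_on fst (arcs (fst \<Lambda>))" "inj_on snd (arcs (fst \<Lambda>))" by (simp_all add: matching_def)
      have sub: "color_class \<Lambda> c \<subseteq> arcs (fst \<Lambda>)" for c by (auto simp: color_class_def)
      have "matching (color_class \<Lambda> c)" for c
        using M sub[of c] finite_subset inj_on_subset unfolding matching_def by (metis subsetD)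
      then have "F \<in> {1..r} \<rightarrow>\<^sub>E Collect matching" by (auto simp: F)
      moreover have "fst ` color_class \<Lambda> c \<inter> fst ` color_class \<Lambda> d = {} \<and>
          snd ` color_class \<Lambda> c \<inter> snd ` color_class \<Lambda> d = {}" if "c \<noteq> d" for c d
      proof -
        have "color_class \<Lambda> c \<inter> color_class \<Lambda> d = {}" using that by (auto simp: color_class_def)
        then show ?thesis
          using inj_on_image_Int[OF inj(1) sub sub] inj_on_image_Int[OF inj(2) sub sub] by (metis image_empty)
      qed
      moreover have "(\<Union>c\<in>{1..r}. fst ` F c) = {1..n} - T"
        using fst_arcs[OF col(1)[OF L]] union[OF L] L by (simp add: F image_UN[symmetric])
      moreover have "(\<Union>c\<in>{1..r}. snd ` F c) = {1..n} - S"
        using snd_arcs[OF col(1)[OF L]] union[OF L] L by (simp add: F image_UN[symmetric])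
      ultimately show "F \<in> ?B" by (simp add: arc_families_def F)
    qed
    show "?B \<subseteq> ?f ` ?A"
    proof
      fix F assume "F \<in> ?B"
      then have F: "F \<in> {1..r} \<rightarrow>\<^sub>E Collect matching"
        "\<And>c d. c \<in> {1..r} \<Longrightarrow> d \<in> {1..r} \<Longrightarrow> c \<noteq> d \<Longrightarrow> fst ` F c \<inter> fst ` F d = {} \<and> snd ` F c \<inter> snd ` F d = {}"
        "(\<Union>c\<in>{1..r}. fst ` F c) = {1..n} - T" "(\<Union>c\<in>{1..r}. snd ` F c) = {1..n} - S"
        by (simp_all add: arc_families_def)
      define A where "A = (\<Union>c\<in>{1..r}. F c)"
      have m: "matching (F c)" if "c \<in> {1..r}" for c using PiE_mem[OF F(1) that] by simp
      have same: "c = d" if "c \<in> {1..r}" "d \<in> {1..r}" "a \<in> F c" "b \<in> F d" "fst a = fst b \<or> snd a = snd b" for a b c d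
        using F(2)[OF that(1,2)] that(3-5) by blast
      have "matching A"
        unfolding matching_def
      proof (intro conjI)
        show "finite A" using m by (auto simp: A_def matching_def)
        show "\<forall>a\<in>A. fst a < snd a" using m by (auto simp: A_def matching_def)
        show "inj_on fst A"
        proof (rule inj_onI)
          fix a b assume "a \<in> A" "b \<in> A" "fst a = fst b"
          then obtain c d where cd: "c \<in> {1..r}" "d \<in> {1..r}" "a \<in> F c" "b \<in> F d" by (auto simp: A_def)
          then have "c = d" using same \<open>fst a = fst b\<close> by blast
          then show "a = b" using m[OF cd(1)] cd \<open>fst a = fst b\<close> by (meson inj_onD matching_def)
        qed
        show "inj_on snd A"
        proof (rule inj_onI)
          fix a b assume "a \<in> A" "b \<in> A" "snd a = snd b"
          then obtain c d where cd: "c \<in> {1..r}" "d \<in> {1..r}" "a \<in> F c" "b \<in> F d" by (auto simp: A_def)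
          then have "c = d" using same \<open>snd a = snd b\<close> by blast
          then show "a = b" using m[OF cd(1)] cd \<open>snd a = snd b\<close> by (meson inj_onD matching_def)
        qed
      qed
      moreover have fA: "fst ` A = {1..n} - T" "snd ` A = {1..n} - S"
        using F(3,4) by (simp_all add: A_def image_UN)
      have "A \<subseteq> {1..n} \<times> {1..n}"
      proof
        fix a assume "a \<in> A"
        then have "fst a \<in> {1..n}" "snd a \<in> {1..n}" using fA by blast+
        then show "a \<in> {1..n} \<times> {1..n}" by (simp add: mem_Times_iff)
      qed
      ultimately obtain P where P: "partition_on {1..n} P" "arcs P = A" using partition_of_matching by blast
      have "\<forall>a\<in>A. \<exists>c. c \<in> {1..r} \<and> a \<in> F c" by (auto simp: A_def)
      then obtain col where col: "\<And>a. a \<in> A \<Longrightarrow> col a \<in> {1..r} \<and> a \<in> F (col a)" by metis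
      define \<Lambda> where "\<Lambda> = (P, restrict col A)"
      \<comment> \<open>Minima and maxima are recovered as the complements of closers and openers in
        \<open>{1..n}\<close>.\<close>
      have "block_mins P = S" "block_maxs P = T"
        using fst_arcs[OF P(1)] snd_arcs[OF P(1)] block_extrema_subset[OF P(1)] fA P(2) assms
        by (metis double_diff order_refl)+
      moreover have "restrict col A \<in> A \<rightarrow>\<^sub>E {1..r}" using col by (simp add: restrict_PiE_iff)
      ultimately have "\<Lambda> \<in> ?A" using P by (simp add: \<Lambda>_def colored_partitions_def)
      moreover have "color_class \<Lambda> c = F c" if c: "c \<in> {1..r}" for c
      proof
        show "color_class \<Lambda> c \<subseteq> F c" using col P(2) by (auto simp: color_class_def \<Lambda>_def)
        show "F c \<subseteq> color_class \<Lambda> c"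
        proof
          fix a assume a: "a \<in> F c"
          then have "a \<in> A" using c by (auto simp: A_def)
          then have "col a = c" using col[OF \<open>a \<in> A\<close>] same[of "col a" c a a] a c by blast
          then show "a \<in> color_class \<Lambda> c" using \<open>a \<in> A\<close> P(2) by (simp add: color_class_def \<Lambda>_def)
        qed
      qed
      then have "?f \<Lambda> = F" using F(1) by (intro ext) (simp add: PiE_def extensional_def restrict_def)
      ultimately show "F \<in> ?f ` ?A" by blast
    qed
  qed
qed

lemma NCN_eq_card_families:
  fixes j k :: int
  assumes "r > 0" "S \<subseteq> {1..n}" "T \<subseteq> {1..n}"
  defines "X \<equiv> {F \<in> arc_families ({1..n} - T) ({1..n} - S) r. \<forall>c\<in>{1..r}. avoiding (nat j) (nat k) (F c)}"
  shows "NCN S T j k n r = card X \<and> finite X"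
proof -
  let ?A = "{\<Lambda> \<in> colored_partitions n r. block_mins (fst \<Lambda>) = S \<and> block_maxs (fst \<Lambda>) = T}"
  have "bij_betw (\<lambda>\<Lambda>. restrict (color_class \<Lambda>) {1..r}) {\<Lambda> \<in> ?A. int (cr \<Lambda>) < j \<and> int (ne \<Lambda>) < k} X"
    unfolding X_def
  proof (rule bij_betw_Collect_conj[OF bij_betw_color_classes[OF assms(2,3)]])
    fix \<Lambda> assume "\<Lambda> \<in> ?A"
    then have L: "\<Lambda> \<in> colored_partitions n r" by simp
    show "(\<forall>c\<in>{1..r}. avoiding (nat j) (nat k) (restrict (color_class \<Lambda>) {1..r} c)) \<longleftrightarrow>
        int (cr \<Lambda>) < j \<and> int (ne \<Lambda>) < k"
      unfolding cr_less_iff[OF L assms(1)] ne_less_iff[OF L assms(1)] avoiding_def by auto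
  qed
  moreover have "{\<Lambda> \<in> ?A. int (cr \<Lambda>) < j \<and> int (ne \<Lambda>) < k} = {\<Lambda> \<in> colored_partitions n r. int (cr \<Lambda>) < j \<and> int (ne \<Lambda>) < k \<and>
      block_mins (fst \<Lambda>) = S \<and> block_maxs (fst \<Lambda>) = T}" (is "_ = ?N") by blast
  ultimately have b: "bij_betw (\<lambda>\<Lambda>. restrict (color_class \<Lambda>) {1..r}) ?N X" by simp
  have "finite ?N" using finite_colored_partitions by (rule finite_subset[rotated]) blast
  then show ?thesis unfolding NCN_def using bij_betw_same_card[OF b] bij_betw_finite[OF b] by simp
qed

theorem theorem1p4:
  fixes n r :: nat and j k :: int and S T :: "nat set"
  assumes "n > 0" and "r > 0" and "S \<subseteq> {1..n}" and "T \<subseteq> {1..n}"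
  shows "NCN S T j k n r = NCN S T k j n r"
  using NCN_eq_card_families[OF assms(2-4), of j k] NCN_eq_card_families[OF assms(2-4), of k j]
    card_arc_families_le[of "{1..n} - T" "{1..n} - S" r "nat k" "nat j"]
    card_arc_families_le[of "{1..n} - T" "{1..n} - S" r "nat j" "nat k"]
  by simp

end
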